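(* The forcing $\mathbb{FSP}$ adds a generic real \[ x_G=\bigcup\{\mathrm{stem}(p): p\in G\} \] (where $G$ is an $\mathbb{FSP}$-generic filter over the ground model) such that for any infinite set $\{\{n_i,n_i+1\}: i<\omega\}$ in the ground model there are infinitely many $i$ such that \[ |x_G\cap\{n_i,n_i+1\}|=1. \]
   Context: A tree is a nonempty set $p \subseteq 2^{<\omega}$ closed under initial segments ($\trianglelefteq$ denotes the initial segment relation and $\triangleleft$ its strict version; $|t|$ is the length of $t$). A node $t\in p$ is splitting if both $t^\frown 0, t^\frown 1 \in p$; $\mathrm{Split}(p)$ is the set of splitting nodes. $p$ is perfect if every node of $p$ is extended (not necessarily properly) by a splitting node of $p$. $\mathrm{stem}(p)$ is the $\trianglelefteq$-least splitting node of $p$. $\mathrm{Lev}_n(p)=\{t\in p: |t|=n\}$ and $p\upharpoonright t=\{s\in p : s\trianglelefteq t \text{ or } t\triangleleft s\}$. $\mathbb{FSP}$ (fat splitting tree forcing) is the set of perfect trees $p\subseteq 2^{<\omega}$ such that for every $t\in p$ there is $k\in\omega$ such that for every $n\in\omega$ with $n\ge k-1$ there is $t'\in \mathrm{Lev}_n(p\upharpoonright t)$ with $t'\in\mathrm{Split}(p)$; ordered by $q\le p$ iff $q\subseteq p$. The real $x_G\in 2^\omega$ is identified with the subset $\{n: x_G(n)=1\}$ of $\omega$. *)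

theory Defs
  imports Main "HOL-Library.Sublist"
begin

section \<open>Trees and the fat splitting forcing\<close>

text \<open>Nodes of the binary tree are boolean lists, \<^const>\<open>False\<close> standing for the digit 0 and
  \<^const>\<open>True\<close> for the digit 1.\<close>

definition is_tree :: "bool list set \<Rightarrow> bool" where
  "is_tree p \<longleftrightarrow> p \<noteq> {} \<and> (\<forall>t\<in>p. \<forall>s. prefix s t \<longrightarrow> s \<in> p)"

definition Split :: "bool list set \<Rightarrow> bool list set" where
  "Split p = {t \<in> p. t @ [False] \<in> p \<and> t @ [True] \<in> p}"

definition perfect_tree :: "bool list set \<Rightarrow> bool" where
  "perfect_tree p \<longleftrightarrow> is_tree p \<and> (\<forall>t\<in>p. \<exists>s\<in>Split p. prefix t s)"

definition stem :: "bool list set \<Rightarrow> bool list" where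
  "stem p = (THE t. t \<in> Split p \<and> (\<forall>s\<in>Split p. prefix t s))"

definition Lev :: "nat \<Rightarrow> bool list set \<Rightarrow> bool list set" where
  "Lev n p = {t \<in> p. length t = n}"

definition restrict_tree :: "bool list set \<Rightarrow> bool list \<Rightarrow> bool list set" where
  "restrict_tree p t = {s \<in> p. prefix s t \<or> strict_prefix t s}"

text \<open>The order on conditions is inclusion. Truncated subtraction is harmless in \<open>k - 1\<close>.\<close>

definition FSP :: "bool list set set" where
  "FSP = {p. perfect_tree p \<and>
     (\<forall>t\<in>p. \<exists>k::nat. \<forall>n. n \<ge> k - 1 \<longrightarrow> (\<exists>t'\<in>Lev n (restrict_tree p t). t' \<in> Split p))}"


section \<open>Transitive models of ZFC\<close>

text \<open>First-order formulas of the language of set theory, with de Bruijn indices.\<close>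

datatype fm = Mem nat nat | Eq nat nat | Neg fm | Conj fm fm | All fm

primrec sat :: "('m \<Rightarrow> 'm \<Rightarrow> bool) \<Rightarrow> fm \<Rightarrow> (nat \<Rightarrow> 'm) \<Rightarrow> bool" where
  "sat E (Mem i j) e \<longleftrightarrow> E (e i) (e j)"
| "sat E (Eq i j) e \<longleftrightarrow> e i = e j"
| "sat E (Neg \<phi>) e \<longleftrightarrow> \<not> sat E \<phi> e"
| "sat E (Conj \<phi> \<psi>) e \<longleftrightarrow> sat E \<phi> e \<and> sat E \<psi> e"
| "sat E (All \<phi>) e \<longleftrightarrow> (\<forall>x. sat E \<phi> (case_nat x e))"

text \<open>A transitive model is presented, up to its Mostowski collapse, as a type with a well-founded
  extensional relation \<open>E\<close>, where \<open>E x y\<close> reads: \<open>x\<close> is a member of \<open>y\<close>. The assignment \<open>e\<close> in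
  the two axiom schemes supplies the parameters.\<close>

locale transitive_ZFC_model =
  fixes E :: "'m \<Rightarrow> 'm \<Rightarrow> bool"
  assumes well_founded: "wfP E"
    and extensionality: "(\<And>z. E z x \<longleftrightarrow> E z y) \<Longrightarrow> x = y"
    and pairing: "\<exists>z. \<forall>w. E w z \<longleftrightarrow> w = x \<or> w = y"
    and union: "\<exists>u. \<forall>w. E w u \<longleftrightarrow> (\<exists>y. E y x \<and> E w y)"
    and power_set: "\<exists>y. \<forall>w. E w y \<longleftrightarrow> (\<forall>z. E z w \<longrightarrow> E z x)"
    and infinity: "\<exists>x. (\<exists>y. E y x \<and> (\<forall>z. \<not> E z y)) \<and>
        (\<forall>y. E y x \<longrightarrow> (\<exists>s. E s x \<and> (\<forall>z. E z s \<longleftrightarrow> E z y \<or> z = y)))"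
    and separation: "\<exists>y. \<forall>z. E z y \<longleftrightarrow> E z x \<and> sat E \<phi> (case_nat z e)"
    and replacement: "(\<And>z. E z x \<Longrightarrow> \<exists>!w. sat E \<phi> (case_nat z (case_nat w e))) \<Longrightarrow>
        \<exists>y. \<forall>w. E w y \<longleftrightarrow> (\<exists>z. E z x \<and> sat E \<phi> (case_nat z (case_nat w e)))"
    and choice: "\<lbrakk>\<And>y. E y x \<Longrightarrow> \<exists>z. E z y;
        \<And>y y' z. \<lbrakk>E y x; E y' x; E z y; E z y'\<rbrakk> \<Longrightarrow> y = y'\<rbrakk> \<Longrightarrow>
        \<exists>c. \<forall>y. E y x \<longrightarrow> (\<exists>!z. E z y \<and> E z c)"


section \<open>Objects belonging to a model\<close>

text \<open>The relations below say that an element of the model is the set-theoretic counterpart of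
  a HOL object: naturals are von Neumann ordinals, pairs are Kuratowski pairs, a node is a finite
  function into \<open>{0, 1}\<close>, and a set of coded objects is the set of their codes. A HOL object
  belongs to the model iff it has a code in it.\<close>

definition ext :: "('m \<Rightarrow> 'm \<Rightarrow> bool) \<Rightarrow> 'm \<Rightarrow> 'm set" where
  "ext E a = {x. E x a}"

definition set_code :: "('m \<Rightarrow> 'm \<Rightarrow> bool) \<Rightarrow> ('a \<Rightarrow> 'm \<Rightarrow> bool) \<Rightarrow> 'a set \<Rightarrow> 'm \<Rightarrow> bool" where
  "set_code E R X a \<longleftrightarrow> rel_set R X (ext E a)"

primrec nat_code :: "('m \<Rightarrow> 'm \<Rightarrow> bool) \<Rightarrow> nat \<Rightarrow> 'm \<Rightarrow> bool" where
  "nat_code E 0 a \<longleftrightarrow> ext E a = {}"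
| "nat_code E (Suc n) a \<longleftrightarrow> (\<exists>b. nat_code E n b \<and> ext E a = insert b (ext E b))"

definition is_pair :: "('m \<Rightarrow> 'm \<Rightarrow> bool) \<Rightarrow> 'm \<Rightarrow> 'm \<Rightarrow> 'm \<Rightarrow> bool" where
  "is_pair E u v a \<longleftrightarrow> (\<exists>s d. ext E s = {u} \<and> ext E d = {u, v} \<and> ext E a = {s, d})"

definition digit_code :: "('m \<Rightarrow> 'm \<Rightarrow> bool) \<Rightarrow> nat \<times> bool \<Rightarrow> 'm \<Rightarrow> bool" where
  "digit_code E z a \<longleftrightarrow>
     (\<exists>u v. nat_code E (fst z) u \<and> nat_code E (of_bool (snd z)) v \<and> is_pair E u v a)"

definition graph_of :: "bool list \<Rightarrow> (nat \<times> bool) set" where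
  "graph_of s = {(i, s ! i) | i. i < length s}"

definition node_code :: "('m \<Rightarrow> 'm \<Rightarrow> bool) \<Rightarrow> bool list \<Rightarrow> 'm \<Rightarrow> bool" where
  "node_code E s a \<longleftrightarrow> set_code E (digit_code E) (graph_of s) a"

definition tree_code :: "('m \<Rightarrow> 'm \<Rightarrow> bool) \<Rightarrow> bool list set \<Rightarrow> 'm \<Rightarrow> bool" where
  "tree_code E = set_code E (node_code E)"

definition in_model :: "('a \<Rightarrow> 'm \<Rightarrow> bool) \<Rightarrow> 'a \<Rightarrow> bool" where
  "in_model R X \<longleftrightarrow> (\<exists>a. R X a)"


section \<open>Generic filters and the generic real\<close>

text \<open>The forcing as computed in the model; the definition of \<^const>\<open>FSP\<close> is arithmetical in the
  tree, hence absolute.\<close>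

definition FSP_in :: "('m \<Rightarrow> 'm \<Rightarrow> bool) \<Rightarrow> bool list set set" where
  "FSP_in E = {p \<in> FSP. in_model (tree_code E) p}"

definition is_dense :: "'a set set \<Rightarrow> 'a set set \<Rightarrow> bool" where
  "is_dense P D \<longleftrightarrow> D \<subseteq> P \<and> (\<forall>p\<in>P. \<exists>q\<in>D. q \<subseteq> p)"

definition is_filter :: "'a set set \<Rightarrow> 'a set set \<Rightarrow> bool" where
  "is_filter P G \<longleftrightarrow> G \<noteq> {} \<and> G \<subseteq> P \<and>
     (\<forall>p\<in>G. \<forall>q\<in>P. p \<subseteq> q \<longrightarrow> q \<in> G) \<and>
     (\<forall>p\<in>G. \<forall>q\<in>G. \<exists>r\<in>G. r \<subseteq> p \<and> r \<subseteq> q)"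

definition FSP_generic :: "('m \<Rightarrow> 'm \<Rightarrow> bool) \<Rightarrow> bool list set set \<Rightarrow> bool" where
  "FSP_generic E G \<longleftrightarrow> is_filter (FSP_in E) G \<and>
     (\<forall>D. is_dense (FSP_in E) D \<and> in_model (set_code E (tree_code E)) D \<longrightarrow> G \<inter> D \<noteq> {})"

definition generic_real :: "bool list set set \<Rightarrow> (nat \<times> bool) set" where
  "generic_real G = (\<Union>p\<in>G. graph_of (stem p))"

definition Cantor_space :: "(nat \<times> bool) set set" where
  "Cantor_space = {{(n, x n) | n. True} | x. True}"

definition subset_of_real :: "(nat \<times> bool) set \<Rightarrow> nat set" where
  "subset_of_real x = {n. (n, True) \<in> x}"

end

theory Submission
  imports Defs
begin

text \<open>
  The combinatorics is short. If \<open>p\<close> is a fat tree and \<open>t \<in> p\<close>, then \<open>restrict_tree p t\<close> is again a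
  fat tree, so a property of conditions is dense as soon as every fat tree can be made to satisfy it
  by passing above a suitable node. Three such properties matter:

  \<^item> the stem is longer than a given \<open>n\<close> (go above any node of length greater than \<open>n\<close>), so that the
    stems of the conditions in \<open>G\<close> converge to a real;
  \<^item> the condition excludes a given real \<open>x\<close> (leave \<open>x\<close> at some splitting node), so that the
    generic real is not in the model;
  \<^item> for some pair \<open>{m, m + 1}\<close> of the given infinite family with \<open>m\<close> beyond a given \<open>N\<close>, every
    node of the condition that is long enough takes different values at \<open>m\<close> and \<open>m + 1\<close>. Fatness is used here: from some
    level on every level carries a splitting node, so a pair with large \<open>m\<close> comes with a splitting
    node \<open>t\<close> of length \<open>m + 1\<close>, and the child of \<open>t\<close> whose last digit differs from \<open>t ! m\<close> decides
    the pair as wanted. Perfectness alone would let a tree split at even levels only, copying each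
    digit to the next place.

  The remaining work is to see that the dense sets belong to the model, since genericity speaks of
  those alone. Separation is stated for formulas; the predicate \<open>definable\<close> collects the HOL
  predicates on assignments that a formula expresses, and its closure rules replace writing formulas
  by hand. Inside the model one constructs \<open>\<omega>\<close> (lemma \<open>ex_omega\<close>), the set of all nodes (lemma
  \<open>ex_full_tree\<close>), and shows that being a fat tree is expressed by a formula with that set as a
  parameter (lemma \<open>FSP_formula_iff\<close>). Lemma \<open>generic_meets\<close> then turns a definable property that
  is dense in the above sense into one that some condition in \<open>G\<close> has.

  Finally, the generic real lies in every model \<open>F\<close> containing \<open>G\<close>: it equals the intersection, over
  all \<open>p \<in> G\<close>, of the union of \<open>p\<close> (lemma \<open>generic_real_eq_Inter\<close>), a description
  which needs neither stems nor numbers and to which separation in \<open>F\<close> applies directly.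
\<close>

section \<open>Fat trees\<close>

text \<open>Two incompatible nodes of a tree branch at a splitting node that is shorter than both. Hence a
  splitting node of minimal length is comparable with, and then below, every other one.\<close>

lemma stem_least_split:
  assumes "perfect_tree p"
  shows "stem p \<in> Split p" and "\<And>s. s \<in> Split p \<Longrightarrow> prefix (stem p) s"
proof -
  have tree: "is_tree p" and "Split p \<noteq> {}"
    using assms by (auto simp: perfect_tree_def is_tree_def)
  then obtain t where t: "t \<in> Split p" and min: "\<And>s. s \<in> Split p \<Longrightarrow> length t \<le> length s"
    using ex_has_least_nat[of "\<lambda>s. s \<in> Split p" _ length] by blast
  have least: "prefix t s" if s: "s \<in> Split p" for s
  proof (rule ccontr)
    assume "\<not> prefix t s"
    show False
    proof (cases "prefix s t")
      case True
      with \<open>\<not> prefix t s\<close> have "length s < length t"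
        by (metis prefix_length_less prefix_order.dual_order.not_eq_order_implies_strict prefix_order.order_refl)
      with min[OF s] show False by simp
    next
      case False
      with \<open>\<not> prefix t s\<close> obtain w a as b bs where w: "a \<noteq> b" "t = w @ a # as" "s = w @ b # bs"
        using parallel_decomp[of t s] by (auto simp: parallel_def)
      have "prefix (w @ [a]) t" "prefix (w @ [b]) s" "prefix w t" using w by auto
      then have "w @ [a] \<in> p" "w @ [b] \<in> p" "w \<in> p"
        using tree s t unfolding is_tree_def Split_def by blast+
      with w(1) have "w \<in> Split p" by (cases a; cases b; auto simp: Split_def)
      with min[of w] w show False by simp
    qed
  qed
  have "stem p = t"
    unfolding stem_def using t least by (intro the_equality) (auto intro: prefix_order.antisym)
  with t least show "stem p \<in> Split p" "\<And>s. s \<in> Split p \<Longrightarrow> prefix (stem p) s" by auto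
qed

text \<open>Once \<open>n\<close> is at least the length of \<open>t\<close>, the nodes of length \<open>n\<close> comparable with \<open>t\<close> are those
  extending \<open>t\<close>. Read this way, fatness yields a splitting extension of every node, which is
  perfectness.\<close>

lemma FSP_iff:
  "p \<in> FSP \<longleftrightarrow> is_tree p \<and>
     (\<forall>t\<in>p. \<exists>K. \<forall>n\<ge>K. \<exists>t'\<in>Split p. prefix t t' \<and> length t' = n)"
  (is "_ \<longleftrightarrow> is_tree p \<and> ?fat")
proof (intro iffI conjI)
  assume p: "p \<in> FSP"
  then show "is_tree p" by (simp add: FSP_def perfect_tree_def)
  show ?fat
  proof
    fix t assume "t \<in> p"
    with p obtain k where
      k: "\<And>n. n \<ge> k - 1 \<Longrightarrow> \<exists>t'\<in>Lev n (restrict_tree p t). t' \<in> Split p"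
      unfolding FSP_def by blast
    have "\<exists>t'\<in>Split p. prefix t t' \<and> length t' = n" if n: "n \<ge> max (k - 1) (length t)" for n
    proof -
      obtain t' where t': "t' \<in> Lev n (restrict_tree p t)" "t' \<in> Split p" using k[of n] n by auto
      then have "length t' = n" "prefix t' t \<or> prefix t t'"
        by (auto simp: Lev_def restrict_tree_def strict_prefix_def)
      then have "prefix t t'" using n
        using prefix_length_prefix[of t t t'] by auto
      with t' \<open>length t' = n\<close> show ?thesis by blast
    qed
    then show "\<exists>K. \<forall>n\<ge>K. \<exists>t'\<in>Split p. prefix t t' \<and> length t' = n" by blast
  qed
next
  assume "is_tree p \<and> ?fat"
  then have tree: "is_tree p" and fat: ?fat by auto
  have "perfect_tree p" unfolding perfect_tree_def using tree fat by blast
  moreover have "\<exists>k::nat. \<forall>n. n \<ge> k - 1 \<longrightarrow> (\<exists>t'\<in>Lev n (restrict_tree p t). t' \<in> Split p)"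
    if t: "t \<in> p" for t
  proof -
    obtain K where K: "\<forall>n\<ge>K. \<exists>t'\<in>Split p. prefix t t' \<and> length t' = n"
      using bspec[OF fat t] by blast
    have "\<exists>t'\<in>Lev n (restrict_tree p t). t' \<in> Split p" if n: "n \<ge> Suc K - 1" for n
    proof -
      obtain t' where t': "t' \<in> Split p" "prefix t t'" "length t' = n" using K n by auto
      then have "t' \<in> Lev n (restrict_tree p t)"
        by (auto simp: Lev_def restrict_tree_def strict_prefix_def Split_def)
      with t' show ?thesis by blast
    qed
    then show ?thesis by blast
  qed
  ultimately show "p \<in> FSP" by (simp add: FSP_def)
qed

lemma mem_restrict_tree: "s \<in> restrict_tree p t \<longleftrightarrow> s \<in> p \<and> (prefix s t \<or> prefix t s)"
  by (auto simp: restrict_tree_def strict_prefix_def)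

text \<open>A node of the restriction has an extension above both itself and \<open>t\<close>, and above \<open>t\<close> nothing of
  the tree is lost; so the bound that works for this extension in \<open>p\<close> works in the restriction.\<close>

lemma restrict_tree_FSP:
  assumes "p \<in> FSP" and t: "t \<in> p"
  shows "restrict_tree p t \<in> FSP"
proof -
  have tree: "is_tree p"
    and fat: "\<And>t. t \<in> p \<Longrightarrow> \<exists>K. \<forall>n\<ge>K. \<exists>t'\<in>Split p. prefix t t' \<and> length t' = n"
    using assms(1) by (auto simp: FSP_iff)
  have "is_tree (restrict_tree p t)"
    unfolding is_tree_def mem_restrict_tree
  proof (intro conjI ballI allI impI)
    show "restrict_tree p t \<noteq> {}" using t by (auto simp: mem_restrict_tree)
  next
    fix s r assume s: "s \<in> restrict_tree p t" "prefix r s"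
    then show "r \<in> p" using tree unfolding is_tree_def mem_restrict_tree by blast
    show "prefix r t \<or> prefix t r"
      using s unfolding mem_restrict_tree by (meson prefix_order.trans prefix_same_cases)
  qed
  moreover have "\<exists>K. \<forall>n\<ge>K. \<exists>t'\<in>Split (restrict_tree p t). prefix s t' \<and> length t' = n"
    if s: "s \<in> restrict_tree p t" for s
  proof -
    obtain s' where s': "s' \<in> p" "prefix s s'" "prefix t s'"
      using s t unfolding mem_restrict_tree by blast
    then obtain K where K: "\<forall>n\<ge>K. \<exists>t'\<in>Split p. prefix s' t' \<and> length t' = n"
      using fat by blast
    have "t' \<in> Split (restrict_tree p t)" if "t' \<in> Split p" "prefix s' t'" for t'
    proof -
      have "prefix t t'" using s' that by auto
      then show ?thesis using that by (auto simp: Split_def mem_restrict_tree)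
    qed
    with K s'(2) show ?thesis by (meson prefix_order.trans)
  qed
  ultimately show ?thesis by (simp add: FSP_iff)
qed

lemma FSP_perfect: "p \<in> FSP \<Longrightarrow> perfect_tree p"
  by (simp add: FSP_def)

lemma tree_prefix_closed: "is_tree p \<Longrightarrow> t \<in> p \<Longrightarrow> prefix s t \<Longrightarrow> s \<in> p"
  by (auto simp: is_tree_def)

lemma FSP_is_tree: "p \<in> FSP \<Longrightarrow> is_tree p"
  by (simp add: FSP_iff)

lemma stem_comparable:
  assumes "perfect_tree p" "s \<in> p"
  shows "prefix s (stem p) \<or> prefix (stem p) s"
proof (rule ccontr)
  have tree: "is_tree p" using assms by (simp add: perfect_tree_def)
  note stem = stem_least_split[OF assms(1)]
  assume "\<not> ?thesis"
  then obtain w a as b bs where w: "a \<noteq> b" "stem p = w @ a # as" "s = w @ b # bs"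
    using parallel_decomp[of "stem p" s] by (auto simp: parallel_def)
  have "stem p \<in> p" using stem by (simp add: Split_def)
  have "prefix (w @ [a]) (stem p)" "prefix (w @ [b]) s" "prefix w s" using w by auto
  then have "w @ [a] \<in> p" "w @ [b] \<in> p" "w \<in> p"
    using tree_prefix_closed[OF tree] \<open>stem p \<in> p\<close> assms(2) by blast+
  with w(1) have "w \<in> Split p" by (cases a; cases b; auto simp: Split_def)
  then have "prefix (stem p) w" by (rule stem)
  then have "length (stem p) \<le> length w" by (rule prefix_length_le)
  with w(2) show False by simp
qed

text \<open>A stem strictly below \<open>u\<close> would have both of its children below \<open>u\<close>.\<close>

lemma prefix_stem:
  assumes "perfect_tree p" and "\<And>s. s \<in> p \<Longrightarrow> prefix s u \<or> prefix u s"
  shows "prefix u (stem p)"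
proof (rule ccontr)
  note stem = stem_least_split(1)[OF assms(1)]
  assume "\<not> ?thesis"
  then have "strict_prefix (stem p) u"
    using assms(2)[of "stem p"] stem by (auto simp: Split_def strict_prefix_def)
  then have "length (stem p) < length u" by (rule prefix_length_less)
  moreover have "stem p @ [b] \<in> p" for b
    using stem by (cases b) (auto simp: Split_def)
  ultimately have "prefix (stem p @ [b]) u" for b
    using assms(2)[of "stem p @ [b]"] prefix_length_prefix[of "stem p @ [b]" "stem p @ [b]" u] by auto
  from this[of True] this[of False] show False by (auto simp: prefix_def)
qed


section \<open>Nodes as finite graphs\<close>

lemma mem_graph_of: "(i, b) \<in> graph_of s \<longleftrightarrow> i < length s \<and> s ! i = b"
  by (auto simp: graph_of_def)

lemma graph_of_snoc: "graph_of (s @ [b]) = insert (length s, b) (graph_of s)"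
  by (auto simp: mem_graph_of nth_append less_Suc_eq)

lemma graph_of_Nil: "graph_of [] = {}"
  by (simp add: graph_of_def)

lemma graph_of_subset_iff: "graph_of s \<subseteq> graph_of t \<longleftrightarrow> prefix s t"
proof
  assume sub: "graph_of s \<subseteq> graph_of t"
  have i: "i < length t \<and> t ! i = s ! i" if "i < length s" for i
    using sub that by (metis mem_graph_of subsetD)
  then have "length s \<le> length t" by (metis not_le order.irrefl)
  with i have "take (length s) t = s" by (intro nth_equalityI) auto
  then show "prefix s t" by (metis take_is_prefix)
next
  assume "prefix s t"
  then show "graph_of s \<subseteq> graph_of t" by (auto simp: prefix_def mem_graph_of nth_append)
qed

text \<open>Adding one point to the graph of \<open>t\<close> can give the graph of a node only if the point is placed at
  the end. In the model, this lets the length of a node be spoken of through one-point extensions.\<close>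

lemma graph_of_insert_iff:
  "d \<notin> graph_of t \<and> graph_of u = insert d (graph_of t) \<longleftrightarrow> (\<exists>b. u = t @ [b] \<and> d = (length t, b))"
proof
  assume a: "d \<notin> graph_of t \<and> graph_of u = insert d (graph_of t)"
  have card: "card (graph_of s) = length s \<and> finite (graph_of s)" for s
    by (induction s rule: rev_induct) (auto simp: graph_of_Nil graph_of_snoc mem_graph_of)
  have "prefix t u" using a graph_of_subset_iff by blast
  moreover have "length u = Suc (length t)" using a card[of u] card[of t] by auto
  ultimately obtain zs where zs: "u = t @ zs" "length zs = Suc 0" by (auto simp: prefix_def)
  then obtain b where u: "u = t @ [b]" by (cases zs) auto
  then have "d = (length t, b)" using a by (auto simp: graph_of_snoc mem_graph_of)
  with u show "\<exists>b. u = t @ [b] \<and> d = (length t, b)" by blast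
qed (auto simp: graph_of_snoc mem_graph_of)


section \<open>Definability\<close>

text \<open>Quantifiers bind the variable with index 0 and shift the others. In the rules for them, applying
  the assignment to explicit indices makes the shift disappear by \<open>\<beta>\<close>-reduction, so that backward
  chaining with the rules proves the definability of any concrete first-order condition.\<close>

definition definable :: "('m \<Rightarrow> 'm \<Rightarrow> bool) \<Rightarrow> ((nat \<Rightarrow> 'm) \<Rightarrow> bool) \<Rightarrow> bool" where
  "definable E P \<longleftrightarrow> (\<exists>\<phi>. \<forall>e. sat E \<phi> e \<longleftrightarrow> P e)"

lemma definable_mem: "definable E (\<lambda>e. E (e i) (e j))"
  unfolding definable_def by (rule exI[of _ "Mem i j"]) simp

lemma definable_eq: "definable E (\<lambda>e. e i = e j)"
  unfolding definable_def by (rule exI[of _ "Eq i j"]) simp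

lemma definable_not: "definable E P \<Longrightarrow> definable E (\<lambda>e. \<not> P e)"
  unfolding definable_def by (elim exE, rule exI[of _ "Neg \<phi>" for \<phi>]) simp

lemma definable_conj:
  assumes "definable E P" "definable E Q"
  shows "definable E (\<lambda>e. P e \<and> Q e)"
proof -
  obtain \<phi> \<psi> where "\<And>e. sat E \<phi> e \<longleftrightarrow> P e" "\<And>e. sat E \<psi> e \<longleftrightarrow> Q e"
    using assms by (auto simp: definable_def)
  then show ?thesis unfolding definable_def by (intro exI[of _ "Conj \<phi> \<psi>"]) simp
qed

lemma definable_all:
  assumes "definable E (\<lambda>e. P (\<lambda>i. e (Suc i)) (e 0))"
  shows "definable E (\<lambda>e. \<forall>x. P e x)"
proof -
  obtain \<phi> where "\<And>e. sat E \<phi> e \<longleftrightarrow> P (\<lambda>i. e (Suc i)) (e 0)"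
    using assms by (auto simp: definable_def)
  then show ?thesis unfolding definable_def by (intro exI[of _ "All \<phi>"]) simp
qed

lemma definable_ex:
  assumes "definable E (\<lambda>e. P (\<lambda>i. e (Suc i)) (e 0))"
  shows "definable E (\<lambda>e. \<exists>x. P e x)"
  using definable_not[OF definable_all[of E "\<lambda>e x. \<not> P e x", OF definable_not[OF assms]]] by simp

lemma definable_disj: "definable E P \<Longrightarrow> definable E Q \<Longrightarrow> definable E (\<lambda>e. P e \<or> Q e)"
  using definable_not[OF definable_conj[OF definable_not definable_not]] by simp

lemma definable_imp: "definable E P \<Longrightarrow> definable E Q \<Longrightarrow> definable E (\<lambda>e. P e \<longrightarrow> Q e)"
  unfolding imp_conv_disj by (intro definable_disj definable_not)

lemma definable_iff:
  assumes "definable E P" "definable E Q"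
  shows "definable E (\<lambda>e. P e \<longleftrightarrow> Q e)"
  using definable_conj[OF definable_imp[OF assms] definable_imp[OF assms(2,1)]]
  unfolding iff_conv_conj_imp .

lemmas definable_intros = definable_mem definable_eq definable_not definable_conj definable_all
  definable_ex definable_disj definable_imp definable_iff

definition subset_in :: "('m \<Rightarrow> 'm \<Rightarrow> bool) \<Rightarrow> 'm \<Rightarrow> 'm \<Rightarrow> bool" where
  "subset_in E a b \<longleftrightarrow> (\<forall>w. E w a \<longrightarrow> E w b)"

definition adjoin_in :: "('m \<Rightarrow> 'm \<Rightarrow> bool) \<Rightarrow> 'm \<Rightarrow> 'm \<Rightarrow> 'm \<Rightarrow> bool" where
  "adjoin_in E t z u \<longleftrightarrow> \<not> E z t \<and> (\<forall>w. E w u \<longleftrightarrow> E w t \<or> w = z)"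

definition inductive_in :: "('m \<Rightarrow> 'm \<Rightarrow> bool) \<Rightarrow> 'm \<Rightarrow> bool" where
  "inductive_in E x \<longleftrightarrow> (\<exists>y. E y x \<and> (\<forall>z. \<not> E z y)) \<and>
     (\<forall>y. E y x \<longrightarrow> (\<exists>s. E s x \<and> (\<forall>z. E z s \<longleftrightarrow> E z y \<or> z = y)))"

text \<open>With \<open>W\<close> standing for \<open>\<omega>\<close>: the second component \<open>v\<close> is either empty, which is 0, or has the empty
  set as its only member, which is 1.\<close>

definition digit_in :: "('m \<Rightarrow> 'm \<Rightarrow> bool) \<Rightarrow> 'm \<Rightarrow> 'm \<Rightarrow> bool" where
  "digit_in E z W \<longleftrightarrow> (\<exists>u v. E u W \<and> ((\<forall>x. \<not> E x v) \<or> (\<forall>x. E x v \<longleftrightarrow> (\<forall>y. \<not> E y x))) \<and> is_pair E u v z)"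

text \<open>The element \<open>s\<close>, a set of digits, is a function with domain some \<open>n \<in> W\<close>.\<close>

definition node_in :: "('m \<Rightarrow> 'm \<Rightarrow> bool) \<Rightarrow> 'm \<Rightarrow> 'm \<Rightarrow> bool" where
  "node_in E s W \<longleftrightarrow> (\<exists>n. E n W \<and>
     (\<forall>z. E z s \<longrightarrow> (\<exists>m b. E m n \<and> is_pair E m b z)) \<and>
     (\<forall>m. E m n \<longrightarrow> (\<exists>z b. E z s \<and> is_pair E m b z)) \<and>
     (\<forall>m b b' z z'. E z s \<and> E z' s \<and> is_pair E m b z \<and> is_pair E m b' z' \<longrightarrow> b = b'))"

text \<open>Fatness relative to the set \<open>T\<close> of all nodes, without arithmetic. The threshold is the length of
  the node \<open>r\<close>, and a level above it is the length of an extension \<open>r'\<close> of \<open>r\<close>. That \<open>t'\<close> has the same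
  length as \<open>r'\<close> is expressed by a single digit \<open>z\<close> that extends both to nodes. The node \<open>t'\<close> splits
  if it has two different one-point extensions \<open>u\<close> and \<open>v\<close> in \<open>p\<close>.\<close>

definition FSP_formula :: "('m \<Rightarrow> 'm \<Rightarrow> bool) \<Rightarrow> 'm \<Rightarrow> 'm \<Rightarrow> bool" where
  "FSP_formula E p T \<longleftrightarrow> (\<exists>t. E t p) \<and>
     (\<forall>t s. E t p \<and> E s T \<and> subset_in E s t \<longrightarrow> E s p) \<and>
     (\<forall>t. E t p \<longrightarrow> (\<exists>r. E r T \<and> (\<forall>r' r'' z.
        E r' T \<and> E r'' T \<and> subset_in E r r' \<and> adjoin_in E r' z r'' \<longrightarrow>
        (\<exists>t' u v z'. E t' p \<and> E u p \<and> E v p \<and> subset_in E t t' \<and>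
           adjoin_in E t' z u \<and> adjoin_in E t' z' v \<and> u \<noteq> v))))"

lemma definable_subset_in: "definable E (\<lambda>e. subset_in E (e i) (e j))"
  unfolding subset_in_def by (intro definable_intros)

lemma definable_adjoin_in: "definable E (\<lambda>e. adjoin_in E (e i) (e j) (e k))"
  unfolding adjoin_in_def by (intro definable_intros)

lemma definable_inductive_in: "definable E (\<lambda>e. inductive_in E (e i))"
  unfolding inductive_in_def by (intro definable_intros)

lemma definable_is_pair: "definable E (\<lambda>e. is_pair E (e i) (e j) (e k))"
  unfolding is_pair_def set_eq_iff ext_def mem_Collect_eq insert_iff empty_iff simp_thms
  by (intro definable_intros)

lemmas definable_basic = definable_subset_in definable_adjoin_in definable_inductive_in
  definable_is_pair definable_intros

lemma definable_digit_in: "definable E (\<lambda>e. digit_in E (e i) (e j))"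
  unfolding digit_in_def by (intro definable_basic)

lemma definable_node_in: "definable E (\<lambda>e. node_in E (e i) (e j))"
  unfolding node_in_def by (intro definable_basic)

lemma definable_FSP_formula: "definable E (\<lambda>e. FSP_formula E (e i) (e j))"
  unfolding FSP_formula_def by (intro definable_basic)


section \<open>Naturals, digits and nodes in a transitive model\<close>

lemma ext_mem: "x \<in> ext E a \<longleftrightarrow> E x a"
  by (simp add: ext_def)

lemma set_code_graph:
  assumes "\<And>x a. R x a \<longleftrightarrow> a = f x"
  shows "set_code E R X a \<longleftrightarrow> ext E a = f ` X"
  unfolding set_code_def rel_set_def by (auto simp: assms)

context transitive_ZFC_model
begin

lemma ext_inject: "ext E a = ext E b \<longleftrightarrow> a = b"
  using extensionality[of a b] by (auto simp: ext_def set_eq_iff)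

lemma not_mem_self: "\<not> E a a"
  using well_founded by (metis wfp_imp_irreflp irreflpD)

text \<open>Separation for definable predicates: \<open>z\<close> is the member under test, and the other arguments are
  parameters.\<close>

lemma separation_definable3:
  assumes "definable E (\<lambda>e. Q (e 0) (e (Suc 0)) (e (Suc (Suc 0))) (e (Suc (Suc (Suc 0)))))"
  shows "\<exists>y. \<forall>z. E z y \<longleftrightarrow> E z x \<and> Q z a b c"
proof -
  obtain \<phi> where \<phi>: "\<And>e. sat E \<phi> e \<longleftrightarrow> Q (e 0) (e (Suc 0)) (e (Suc (Suc 0))) (e (Suc (Suc (Suc 0))))"
    using assms by (auto simp: definable_def)
  show ?thesis
    using separation[of x \<phi> "case_nat a (case_nat b (\<lambda>_. c))"] by (simp add: \<phi>)
qed

lemma separation_definable1: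
  assumes "definable E (\<lambda>e. Q (e 0) (e (Suc 0)))"
  shows "\<exists>y. \<forall>z. E z y \<longleftrightarrow> E z x \<and> Q z a"
  using separation_definable3[of "\<lambda>z a b c. Q z a" x a a a] assms by simp

lemma ex_adjoin: "\<exists>c. ext E c = insert b (ext E a)"
proof -
  obtain s where s: "\<And>w. E w s \<longleftrightarrow> w = b" using pairing[of b b] by auto
  obtain d where d: "\<And>w. E w d \<longleftrightarrow> w = a \<or> w = s" using pairing[of a s] by auto
  obtain c where "\<And>w. E w c \<longleftrightarrow> (\<exists>y. E y d \<and> E w y)" using union[of d] by auto
  then have "ext E c = insert b (ext E a)" by (auto simp: ext_def d s)
  then show ?thesis ..
qed

lemma ex_power: "\<exists>y. \<forall>w. E w y \<longleftrightarrow> ext E w \<subseteq> ext E x"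
  using power_set[of x] by (auto simp: ext_def subset_eq)

lemma ex_empty: "\<exists>y. ext E y = {}"
proof -
  obtain x y where "E y x" "\<forall>z. \<not> E z y" using infinity by blast
  then show ?thesis by (auto simp: ext_def)
qed

text \<open>The coding relations of a model turn out to be graphs of total injective functions; these are the
  functions.\<close>

definition nat_elem :: "nat \<Rightarrow> 'm" where "nat_elem n = (THE a. nat_code E n a)"
definition digit_elem :: "nat \<times> bool \<Rightarrow> 'm" where "digit_elem z = (THE a. digit_code E z a)"
definition node_elem :: "bool list \<Rightarrow> 'm" where "node_elem s = (THE a. node_code E s a)"

lemma ext_ex1: "\<exists>a. ext E a = S \<Longrightarrow> \<exists>!a. ext E a = S"
  using ext_inject by blast

lemma nat_code_ex1: "\<exists>!a. nat_code E n a"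
proof (induction n)
  case 0
  then show ?case using ext_ex1[OF ex_empty] by simp
next
  case (Suc n)
  then obtain b where b: "nat_code E n b" "\<And>b'. nat_code E n b' \<Longrightarrow> b' = b" by auto
  then have "nat_code E (Suc n) a \<longleftrightarrow> ext E a = insert b (ext E b)" for a
    unfolding nat_code.simps by blast
  then show ?case using ext_ex1[OF ex_adjoin] by simp
qed

lemma nat_code_iff: "nat_code E n a \<longleftrightarrow> a = nat_elem n"
  unfolding nat_elem_def using theI'[OF nat_code_ex1] the1_equality[OF nat_code_ex1] by metis

lemma ext_nat_elem: "ext E (nat_elem n) = nat_elem ` {..<n}"
proof (induction n)
  case 0
  have "nat_code E 0 (nat_elem 0)" by (simp only: nat_code_iff)
  then show ?case by (simp only: nat_code.simps lessThan_0 image_empty)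
next
  case (Suc n)
  have "nat_code E (Suc n) (nat_elem (Suc n))" by (simp only: nat_code_iff)
  then have "ext E (nat_elem (Suc n)) = insert (nat_elem n) (ext E (nat_elem n))"
    unfolding nat_code.simps by (simp add: nat_code_iff)
  then show ?case by (simp add: Suc lessThan_Suc)
qed

lemma nat_elem_inject: "nat_elem m = nat_elem n \<longleftrightarrow> m = n"
proof -
  have less: "nat_elem m \<noteq> nat_elem n" if "m < n" for m n
  proof
    assume "nat_elem m = nat_elem n"
    with that have "nat_elem n \<in> ext E (nat_elem n)" unfolding ext_nat_elem by (metis imageI lessThan_iff)
    with not_mem_self show False by (simp add: ext_def)
  qed
  show ?thesis using less[of m n] less[of n m] by (metis linorder_neqE_nat)
qed

lemma mem_nat_elem: "E x (nat_elem n) \<longleftrightarrow> (\<exists>m<n. x = nat_elem m)"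
  using ext_nat_elem[of n] by (auto simp: ext_def)

lemma mem_nat_elem_nat_elem: "E (nat_elem m) (nat_elem n) \<longleftrightarrow> m < n"
  by (auto simp: mem_nat_elem nat_elem_inject)

lemma is_pair_ex: "\<exists>a. is_pair E u v a"
proof -
  obtain o1 where o1: "ext E o1 = {}" using ex_empty by blast
  obtain s where s: "ext E s = {u}" using ex_adjoin[of u o1] o1 by auto
  obtain d where d: "ext E d = {u, v}" using ex_adjoin[of v s] s by auto
  obtain a0 where a0: "ext E a0 = {d}" using ex_adjoin[of d o1] o1 by auto
  obtain a where a: "ext E a = {s, d}" using ex_adjoin[of s a0] a0 by auto
  show ?thesis unfolding is_pair_def using s d a by blast
qed

lemma is_pair_unique: "is_pair E u v a \<Longrightarrow> is_pair E u v a' \<Longrightarrow> a = a'"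
  unfolding is_pair_def by (metis ext_inject)

lemma is_pair_inject:
  assumes "is_pair E u v a" "is_pair E u' v' a"
  shows "u = u' \<and> v = v'"
proof -
  obtain s d where 1: "ext E s = {u}" "ext E d = {u, v}" "ext E a = {s, d}"
    using assms(1) by (auto simp: is_pair_def)
  obtain s' d' where 2: "ext E s' = {u'}" "ext E d' = {u', v'}" "ext E a = {s', d'}"
    using assms(2) by (auto simp: is_pair_def)
  have "ext E ` ext E a = {{u}, {u, v}}" unfolding 1(3) by (simp add: 1(1,2))
  moreover have "ext E ` ext E a = {{u'}, {u', v'}}" unfolding 2(3) by (simp add: 2(1,2))
  ultimately have "{{u}, {u, v}} = {{u'}, {u', v'}}" by simp
  then show ?thesis by (auto simp: doubleton_eq_iff)
qed

lemma nat_elem_of_bool_inject: "nat_elem (of_bool b) = nat_elem (of_bool b') \<longleftrightarrow> b = b'"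
  unfolding nat_elem_inject by simp

lemma digit_code_iff_pair: "digit_code E (n, b) a \<longleftrightarrow> is_pair E (nat_elem n) (nat_elem (of_bool b)) a"
  by (simp add: digit_code_def nat_code_iff)

lemma digit_code_iff: "digit_code E z a \<longleftrightarrow> a = digit_elem z"
proof -
  obtain n b where z: "z = (n, b)" by fastforce
  have "\<exists>!a. digit_code E z a"
    unfolding z digit_code_iff_pair using is_pair_ex is_pair_unique by blast
  then show ?thesis unfolding digit_elem_def by (metis theI' the1_equality)
qed

lemma is_pair_digit_elem: "is_pair E u v (digit_elem (n, b)) \<longleftrightarrow> u = nat_elem n \<and> v = nat_elem (of_bool b)"
proof -
  have "is_pair E (nat_elem n) (nat_elem (of_bool b)) (digit_elem (n, b))"
    using digit_code_iff digit_code_iff_pair by blast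
  then show ?thesis using is_pair_inject by blast
qed

lemma digit_elem_inject: "digit_elem z = digit_elem z' \<longleftrightarrow> z = z'"
proof
  assume eq: "digit_elem z = digit_elem z'"
  obtain n b n' b' where z: "z = (n, b)" "z' = (n', b')" by fastforce
  have "is_pair E (nat_elem n) (nat_elem (of_bool b)) (digit_elem (n, b))" by (simp add: is_pair_digit_elem)
  then have "is_pair E (nat_elem n) (nat_elem (of_bool b)) (digit_elem (n', b'))" using eq z by simp
  then have "n = n'" "b = b'"
    unfolding is_pair_digit_elem nat_elem_of_bool_inject by (simp_all add: nat_elem_inject)
  with z show "z = z'" by simp
qed simp

lemma inj_digit_elem: "inj digit_elem"
  by (simp add: inj_def digit_elem_inject)

lemma digit_set_code_iff: "set_code E (digit_code E) X a \<longleftrightarrow> ext E a = digit_elem ` X"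
  by (rule set_code_graph) (rule digit_code_iff)

lemma node_code_ex1: "\<exists>!a. node_code E s a"
proof (induction s rule: rev_induct)
  case Nil
  then show ?case using ext_ex1[OF ex_empty]
    by (simp add: node_code_def digit_set_code_iff graph_of_Nil)
next
  case (snoc b s)
  then obtain a where a: "ext E a = digit_elem ` graph_of s"
    by (auto simp: node_code_def digit_set_code_iff)
  then have "digit_elem ` graph_of (s @ [b]) = insert (digit_elem (length s, b)) (ext E a)"
    by (simp add: graph_of_snoc)
  then show ?case unfolding node_code_def digit_set_code_iff
    using ext_ex1[OF ex_adjoin] by simp
qed

lemma node_code_iff: "node_code E s a \<longleftrightarrow> a = node_elem s"
  unfolding node_elem_def using theI'[OF node_code_ex1] the1_equality[OF node_code_ex1] by metis

lemma ext_node_elem: "ext E (node_elem s) = digit_elem ` graph_of s"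
  using node_code_iff by (metis node_code_def digit_set_code_iff)

lemma mem_node_elem: "E x (node_elem s) \<longleftrightarrow> (\<exists>z\<in>graph_of s. x = digit_elem z)"
  using ext_node_elem[of s] by (auto simp: ext_def)

lemma digit_elem_mem_node_elem: "E (digit_elem z) (node_elem s) \<longleftrightarrow> z \<in> graph_of s"
  by (auto simp: mem_node_elem digit_elem_inject)

lemma subset_in_node_elem: "subset_in E (node_elem s) (node_elem t) \<longleftrightarrow> prefix s t"
  unfolding subset_in_def mem_node_elem graph_of_subset_iff[symmetric] by (auto simp: digit_elem_inject)

lemma node_elem_inject: "node_elem s = node_elem t \<longleftrightarrow> s = t"
  by (metis subset_in_node_elem prefix_order.antisym prefix_order.order_refl)

lemma adjoin_in_node_elem:
  "adjoin_in E (node_elem t) x (node_elem u) \<longleftrightarrow> (\<exists>b. u = t @ [b] \<and> x = digit_elem (length t, b))"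
proof -
  have "adjoin_in E (node_elem t) x (node_elem u) \<longleftrightarrow>
    x \<notin> ext E (node_elem t) \<and> ext E (node_elem u) = insert x (ext E (node_elem t))"
    by (auto simp: adjoin_in_def ext_def)
  also have "\<dots> \<longleftrightarrow> (\<exists>d. x = digit_elem d \<and> d \<notin> graph_of t \<and> graph_of u = insert d (graph_of t))"
  proof (intro iffI; (elim conjE exE)?)
    assume a: "x \<notin> ext E (node_elem t)" "ext E (node_elem u) = insert x (ext E (node_elem t))"
    then have "x \<in> digit_elem ` graph_of u" by (simp flip: ext_node_elem)
    then obtain d where d: "x = digit_elem d" by blast
    with a(2) have "digit_elem ` graph_of u = digit_elem ` insert d (graph_of t)" by (simp add: ext_node_elem)
    then have "graph_of u = insert d (graph_of t)" by (simp only: inj_image_eq_iff[OF inj_digit_elem])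
    with a d show "\<exists>d. x = digit_elem d \<and> d \<notin> graph_of t \<and> graph_of u = insert d (graph_of t)"
      by (intro exI[of _ d]) (auto simp: ext_node_elem)
  qed (auto simp: ext_node_elem digit_elem_inject)
  also have "\<dots> \<longleftrightarrow> (\<exists>d. x = digit_elem d \<and> (\<exists>b. u = t @ [b] \<and> d = (length t, b)))"
    by (simp only: graph_of_insert_iff)
  also have "\<dots> \<longleftrightarrow> (\<exists>b. u = t @ [b] \<and> x = digit_elem (length t, b))"
    by blast
  finally show ?thesis .
qed

lemma tree_code_iff: "tree_code E p a \<longleftrightarrow> ext E a = node_elem ` p"
  unfolding tree_code_def by (rule set_code_graph) (rule node_code_iff)

lemma tree_codeD: "tree_code E p a \<Longrightarrow> E x a \<longleftrightarrow> (\<exists>s\<in>p. x = node_elem s)"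
  by (auto simp: tree_code_iff ext_def)

lemma tree_code_ball: "tree_code E p a \<Longrightarrow> (\<forall>s. E s a \<longrightarrow> R s) \<longleftrightarrow> (\<forall>s\<in>p. R (node_elem s))"
  unfolding tree_codeD by blast

lemma tree_code_bex: "tree_code E p a \<Longrightarrow> (\<exists>s. E s a \<and> R s) \<longleftrightarrow> (\<exists>s\<in>p. R (node_elem s))"
  unfolding tree_codeD by blast

text \<open>Separation gives the least inductive set, and it contains the codes of all natural numbers. There
  is no formula at hand for being such a code; instead, if the set had another member, take an
  \<open>E\<close>-minimal one, \<open>m\<close>. By minimality \<open>m\<close> is neither empty nor a successor of a member, so removing it
  leaves an inductive set, contradicting leastness.\<close>

lemma ex_omega: "\<exists>W. \<forall>x. E x W \<longleftrightarrow> (\<exists>n. x = nat_elem n)"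
proof -
  obtain x0 where x0: "inductive_in E x0" using infinity by (auto simp: inductive_in_def)
  have natc0: "(\<forall>z. \<not> E z y) \<longleftrightarrow> y = nat_elem 0" for y
    using nat_code_iff[of 0 y] by (auto simp: ext_def)
  have natcS: "(\<forall>z. E z s \<longleftrightarrow> E z (nat_elem n) \<or> z = nat_elem n) \<longleftrightarrow> s = nat_elem (Suc n)" for s n
  proof -
    have "(\<forall>z. E z s \<longleftrightarrow> E z (nat_elem n) \<or> z = nat_elem n) \<longleftrightarrow> ext E s = ext E (nat_elem (Suc n))"
      unfolding ext_nat_elem lessThan_Suc by (auto simp: set_eq_iff mem_nat_elem ext_mem)
    then show ?thesis by (simp add: ext_inject)
  qed
  have nat_elem_in: "E (nat_elem n) w" if ind: "inductive_in E w" for n w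
  proof (induction n)
    case 0
    show ?case using ind by (auto simp: inductive_in_def natc0)
  next
    case (Suc n)
    then obtain s where "E s w" "\<forall>z. E z s \<longleftrightarrow> E z (nat_elem n) \<or> z = nat_elem n"
      using ind unfolding inductive_in_def by blast
    then show ?case by (simp add: natcS)
  qed
  have "definable E (\<lambda>e. \<forall>w. inductive_in E w \<longrightarrow> E (e 0) w)"
    by (intro definable_basic)
  note sep = separation_definable1[of "\<lambda>z a. \<forall>w. inductive_in E w \<longrightarrow> E z w" x0 x0, OF this]
  obtain W where W: "\<And>z. E z W \<longleftrightarrow> E z x0 \<and> (\<forall>w. inductive_in E w \<longrightarrow> E z w)"
    using sep by (elim exE) (rule that, erule spec)
  have "\<exists>n. z = nat_elem n" if "E z W" for z
  proof (rule ccontr)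
    assume "\<nexists>n. z = nat_elem n"
    with that obtain m where m: "E m W" "\<nexists>n. m = nat_elem n"
      and min: "\<And>y. E y m \<Longrightarrow> E y W \<Longrightarrow> \<exists>n. y = nat_elem n"
      using wfp_eq_minimal[THEN iffD1, OF well_founded, rule_format, of z "{z. E z W \<and> (\<nexists>n. z = nat_elem n)}"]
      by auto
    have "definable E (\<lambda>e. e 0 \<noteq> e (Suc 0))" by (intro definable_intros)
    from separation_definable1[of "\<lambda>z a. z \<noteq> a" W m, OF this]
    obtain W' where W': "\<And>z. E z W' \<longleftrightarrow> E z W \<and> z \<noteq> m" by blast
    have "inductive_in E W'"
      unfolding inductive_in_def
    proof (intro conjI allI impI)
      have "E (nat_elem 0) W'" using m nat_elem_in x0 by (auto simp: W' W)
      then show "\<exists>y. E y W' \<and> (\<forall>z. \<not> E z y)" using natc0 by blast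
    next
      fix y assume y: "E y W'"
      then have yW: "E y W" by (simp add: W')
      obtain s where s: "\<forall>z. E z s \<longleftrightarrow> E z y \<or> z = y"
        using ex_adjoin[of y y] by (auto simp: ext_def set_eq_iff)
      have "E s w" if ind: "inductive_in E w" for w
      proof -
        have "E y w" using yW ind by (simp add: W)
        then obtain s' where s': "E s' w" "\<forall>z. E z s' \<longleftrightarrow> E z y \<or> z = y"
          using ind unfolding inductive_in_def by blast
        then have "s' = s" using s by (intro extensionality) simp
        with s' show ?thesis by simp
      qed
      then have "E s W" using x0 by (simp add: W)
      moreover have "s \<noteq> m"
      proof
        assume "s = m"
        then obtain n where "y = nat_elem n" using min[of y] s yW by auto
        with s natcS \<open>s = m\<close> m(2) show False by blast
      qed
      ultimately show "\<exists>s. E s W' \<and> (\<forall>z. E z s \<longleftrightarrow> E z y \<or> z = y)" using s W' by blast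
    qed
    with m(1) have "E m W'" by (simp add: W)
    then show False by (simp add: W')
  qed
  then have "\<forall>x. E x W \<longleftrightarrow> (\<exists>n. x = nat_elem n)" using nat_elem_in x0 by (auto simp: W)
  then show ?thesis ..
qed

lemma digit_in_iff:
  assumes W: "\<And>x. E x W \<longleftrightarrow> (\<exists>n. x = nat_elem n)"
  shows "digit_in E z W \<longleftrightarrow> (\<exists>d. z = digit_elem d)"
proof -
  have 0: "(\<forall>x. \<not> E x v) \<longleftrightarrow> v = nat_elem 0" for v
    using nat_code_iff[of 0 v] by (auto simp: ext_def)
  have 1: "(\<forall>x. E x v \<longleftrightarrow> x = nat_elem 0) \<longleftrightarrow> v = nat_elem 1" for v
  proof -
    have "(\<forall>x. E x v \<longleftrightarrow> x = nat_elem 0) \<longleftrightarrow> ext E v = {nat_elem 0}" by (auto simp: ext_def)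
    also have "{nat_elem 0} = ext E (nat_elem 1)" by (simp add: ext_nat_elem lessThan_Suc)
    finally show ?thesis by (simp add: ext_inject)
  qed
  have "digit_in E z W \<longleftrightarrow> (\<exists>n b. is_pair E (nat_elem n) (nat_elem (of_bool b)) z)"
    unfolding digit_in_def 0 1 W by (auto simp: ex_bool_eq)
  also have "\<dots> \<longleftrightarrow> (\<exists>d. z = digit_elem d)"
    by (auto simp: digit_code_iff_pair[symmetric] digit_code_iff)
  finally show ?thesis .
qed

text \<open>From a set \<open>s\<close> of digits that is a function on \<open>N\<close>, the node is read off place by place.\<close>

lemma node_in_iff:
  assumes W: "\<And>x. E x W \<longleftrightarrow> (\<exists>n. x = nat_elem n)" and s: "\<And>z. E z s \<Longrightarrow> \<exists>d. z = digit_elem d"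
  shows "node_in E s W \<longleftrightarrow> (\<exists>t. s = node_elem t)"
proof
  assume "node_in E s W"
  then obtain N where
      low: "\<And>z. E z s \<Longrightarrow> \<exists>m b. E m (nat_elem N) \<and> is_pair E m b z"
    and all: "\<And>m. E m (nat_elem N) \<Longrightarrow> \<exists>z b. E z s \<and> is_pair E m b z"
    and fn: "\<And>m b b' z z'. E z s \<Longrightarrow> E z' s \<Longrightarrow> is_pair E m b z \<Longrightarrow> is_pair E m b' z' \<Longrightarrow> b = b'"
    unfolding node_in_def W by blast
  define X where "X = {d. E (digit_elem d) s}"
  have low': "i < N" if "(i, b) \<in> X" for i b
    using low[of "digit_elem (i, b)"] that by (auto simp: X_def is_pair_digit_elem mem_nat_elem_nat_elem)
  have all': "\<exists>b. (i, b) \<in> X" if i: "i < N" for i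
  proof -
    obtain z b where zb: "E z s" "is_pair E (nat_elem i) b z"
      using all[of "nat_elem i"] i by (auto simp: mem_nat_elem_nat_elem)
    obtain d where d: "z = digit_elem d" using s[OF zb(1)] by blast
    then show ?thesis using zb by (cases d) (auto simp: is_pair_digit_elem nat_elem_inject X_def)
  qed
  have fn': "b = b'" if "(i, b) \<in> X" "(i, b') \<in> X" for i b b'
    using fn[of "digit_elem (i, b)" "digit_elem (i, b')" "nat_elem i"
        "nat_elem (of_bool b)" "nat_elem (of_bool b')"] that
    unfolding is_pair_digit_elem nat_elem_of_bool_inject X_def by auto
  define t where "t = map (\<lambda>i. (i, True) \<in> X) [0..<N]"
  have t: "(i, b) \<in> graph_of t \<longleftrightarrow> i < N \<and> ((i, True) \<in> X \<longleftrightarrow> b)" for i b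
    by (auto simp: mem_graph_of t_def)
  have "(i, b) \<in> graph_of t \<longleftrightarrow> (i, b) \<in> X" for i b
    unfolding t using low'[of i b] all'[of i] fn'[of i] by (metis (full_types))
  then have "graph_of t = X" by auto
  moreover have "ext E s = digit_elem ` X" using s by (auto simp: ext_def X_def)
  ultimately have "s = node_elem t" by (simp add: ext_inject[symmetric] ext_node_elem)
  then show "\<exists>t. s = node_elem t" ..
next
  assume "\<exists>t. s = node_elem t"
  then obtain t where "s = node_elem t" by blast
  then have mem: "E z s \<longleftrightarrow> (\<exists>i<length t. z = digit_elem (i, t ! i))" for z
    by (auto simp: mem_node_elem graph_of_def)
  show "node_in E s W"
    unfolding node_in_def
  proof (rule exI[of _ "nat_elem (length t)"], intro conjI allI impI)
    show "E (nat_elem (length t)) W" by (auto simp: W)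
  next
    fix z assume "E z s"
    then show "\<exists>m b. E m (nat_elem (length t)) \<and> is_pair E m b z"
      by (auto simp: mem is_pair_digit_elem mem_nat_elem_nat_elem)
  next
    fix m assume "E m (nat_elem (length t))"
    then obtain i where "i < length t" "m = nat_elem i" by (auto simp: mem_nat_elem)
    then have "E (digit_elem (i, t ! i)) s" "is_pair E m (nat_elem (of_bool (t ! i))) (digit_elem (i, t ! i))"
      by (auto simp: mem is_pair_digit_elem)
    then show "\<exists>z b. E z s \<and> is_pair E m b z" by blast
  next
    fix m b b' z z'
    assume "E z s \<and> E z' s \<and> is_pair E m b z \<and> is_pair E m b' z'"
    then show "b = b'" by (auto simp: mem is_pair_digit_elem nat_elem_inject)
  qed
qed

text \<open>Digits are sets of sets of naturals and nodes are sets of digits, which bounds both for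
  separation.\<close>

lemma ex_full_tree: "\<exists>T. \<forall>x. E x T \<longleftrightarrow> (\<exists>t. x = node_elem t)"
proof -
  obtain W where W: "\<And>x. E x W \<longleftrightarrow> (\<exists>n. x = nat_elem n)" using ex_omega by blast
  obtain P where P: "\<And>x. E x P \<longleftrightarrow> ext E x \<subseteq> ext E W" using ex_power[of W] by blast
  obtain PP where PP: "\<And>x. E x PP \<longleftrightarrow> ext E x \<subseteq> ext E P" using ex_power[of P] by blast
  obtain D where D: "\<And>z. E z D \<longleftrightarrow> E z PP \<and> digit_in E z W"
    using separation_definable1[of "digit_in E", OF definable_digit_in] by blast
  have "E (digit_elem d) PP" for d
  proof -
    obtain n b where d: "d = (n, b)" by fastforce
    obtain s c where sc: "ext E s = {nat_elem n}" "ext E c = {nat_elem n, nat_elem (of_bool b)}"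
        "ext E (digit_elem d) = {s, c}"
      using is_pair_digit_elem[of "nat_elem n" "nat_elem (of_bool b)" n b] unfolding d is_pair_def by auto
    then have "E s P" "E c P" using P W by (auto simp: ext_def)
    then show ?thesis using sc by (auto simp: PP ext_mem)
  qed
  then have D': "E z D \<longleftrightarrow> (\<exists>d. z = digit_elem d)" for z
    using D[of z] digit_in_iff[OF W] by auto
  obtain PD where PD: "\<And>x. E x PD \<longleftrightarrow> ext E x \<subseteq> ext E D" using ex_power[of D] by blast
  obtain T where T: "\<And>z. E z T \<longleftrightarrow> E z PD \<and> node_in E z W"
    using separation_definable1[of "node_in E", OF definable_node_in] by blast
  have "E x T \<longleftrightarrow> (\<exists>t. x = node_elem t)" for x
  proof -
    have "E (node_elem t) PD" for t by (auto simp: PD D' ext_def mem_node_elem)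
    moreover have "E x PD \<Longrightarrow> E z x \<Longrightarrow> \<exists>d. z = digit_elem d" for z
      by (auto simp: PD D' ext_def)
    moreover have "E z (node_elem t) \<Longrightarrow> \<exists>d. z = digit_elem d" for z t
      by (auto simp: mem_node_elem)
    ultimately show ?thesis
      unfolding T using node_in_iff[OF W, of x] by metis
  qed
  then show ?thesis by blast
qed

text \<open>Absoluteness of the forcing: all quantifiers of the formula are bounded by \<open>p\<close> or by \<open>T\<close>, except
  for digits, which one-point extensions of nodes determine.\<close>

lemma FSP_formula_iff:
  assumes T: "\<And>x. E x T \<longleftrightarrow> (\<exists>t. x = node_elem t)" and a: "tree_code E p a"
  shows "FSP_formula E a T \<longleftrightarrow> p \<in> FSP"
proof -
  note A = tree_codeD[OF a]
  have tree: "(\<exists>t. E t a) \<and> (\<forall>t s. E t a \<and> E s T \<and> subset_in E s t \<longrightarrow> E s a) \<longleftrightarrow> is_tree p"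
  proof -
    have "(\<forall>t s. E t a \<and> E s T \<and> subset_in E s t \<longrightarrow> E s a) \<longleftrightarrow>
        (\<forall>t\<in>p. \<forall>s. subset_in E (node_elem s) (node_elem t) \<longrightarrow> E (node_elem s) a)"
      unfolding A T by blast
    also have "\<dots> \<longleftrightarrow> (\<forall>t\<in>p. \<forall>s. prefix s t \<longrightarrow> s \<in> p)"
      by (simp add: subset_in_node_elem A node_elem_inject)
    finally have "(\<forall>t s. E t a \<and> E s T \<and> subset_in E s t \<longrightarrow> E s a) \<longleftrightarrow>
        (\<forall>t\<in>p. \<forall>s. prefix s t \<longrightarrow> s \<in> p)" .
    moreover have "(\<exists>t. E t a) \<longleftrightarrow> p \<noteq> {}" unfolding A by auto
    ultimately show ?thesis unfolding is_tree_def by simp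
  qed
  have split_level: "(\<exists>t' u v z'. E t' a \<and> E u a \<and> E v a \<and> subset_in E (node_elem t) t' \<and>
           adjoin_in E t' (digit_elem (n, b)) u \<and> adjoin_in E t' z' v \<and> u \<noteq> v) \<longleftrightarrow>
        (\<exists>t'\<in>Split p. prefix t t' \<and> length t' = n)" (is "?L \<longleftrightarrow> ?R") for t n b
  proof
    assume ?L
    then obtain t' u v z' where *: "t' \<in> p" "u \<in> p" "v \<in> p" "prefix t t'"
      "adjoin_in E (node_elem t') (digit_elem (n, b)) (node_elem u)"
      "adjoin_in E (node_elem t') z' (node_elem v)" "u \<noteq> v"
      unfolding A by (auto simp: subset_in_node_elem node_elem_inject)
    then obtain b1 b2 where "u = t' @ [b1]" "v = t' @ [b2]" "length t' = n"
      by (auto simp: adjoin_in_node_elem digit_elem_inject)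
    with * have "t' \<in> Split p" by (cases b1; cases b2; auto simp: Split_def)
    with * \<open>length t' = n\<close> show ?R by blast
  next
    assume ?R
    then obtain t' where t': "t' \<in> Split p" "prefix t t'" "length t' = n" by blast
    then have mem: "t' \<in> p" "t' @ [c] \<in> p" for c by (cases c; auto simp: Split_def)+
    show ?L
      by (rule exI[of _ "node_elem t'"], rule exI[of _ "node_elem (t' @ [b])"],
          rule exI[of _ "node_elem (t' @ [\<not> b])"], rule exI[of _ "digit_elem (n, \<not> b)"])
         (use t' mem in \<open>auto simp: A subset_in_node_elem adjoin_in_node_elem node_elem_inject\<close>)
  qed
  \<comment> \<open>The Boolean \<open>b\<close> below is the last digit of \<open>r''\<close>; afterwards nodes are traded for their lengths,
    using that every number is the length of a node and that every node has extensions of all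
    greater lengths.\<close>
  have level: "(\<exists>r. E r T \<and> (\<forall>r' r'' z.
        E r' T \<and> E r'' T \<and> subset_in E r r' \<and> adjoin_in E r' z r'' \<longrightarrow>
        (\<exists>t' u v z'. E t' a \<and> E u a \<and> E v a \<and> subset_in E (node_elem t) t' \<and>
           adjoin_in E t' z u \<and> adjoin_in E t' z' v \<and> u \<noteq> v))) \<longleftrightarrow>
     (\<exists>K. \<forall>n\<ge>K. \<exists>t'\<in>Split p. prefix t t' \<and> length t' = n)" (is "?L \<longleftrightarrow> ?R") for t
  proof -
    define Q where "Q z \<longleftrightarrow> (\<exists>t' u v z'. E t' a \<and> E u a \<and> E v a \<and> subset_in E (node_elem t) t' \<and>
           adjoin_in E t' z u \<and> adjoin_in E t' z' v \<and> u \<noteq> v)" for z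
    have step: "(\<forall>r'' z. subset_in E (node_elem r) (node_elem r') \<and>
          adjoin_in E (node_elem r') z (node_elem r'') \<longrightarrow> Q z)
        \<longleftrightarrow> (\<forall>b. prefix r r' \<longrightarrow> Q (digit_elem (length r', b)))" for r r'
      unfolding subset_in_node_elem adjoin_in_node_elem by auto
    have "?L \<longleftrightarrow> (\<exists>r. \<forall>r' r'' z. subset_in E (node_elem r) (node_elem r') \<and>
        adjoin_in E (node_elem r') z (node_elem r'') \<longrightarrow> Q z)"
      unfolding T Q_def[symmetric] by blast
    also have "\<dots> \<longleftrightarrow> (\<exists>r::bool list. \<forall>r' b. prefix r r' \<longrightarrow> Q (digit_elem (length r', b)))"
      by (simp only: step)
    also have "\<dots> \<longleftrightarrow> (\<exists>r::bool list. \<forall>r' (b::bool). prefix r r' \<longrightarrow>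
        (\<exists>t'\<in>Split p. prefix t t' \<and> length t' = length r'))"
      unfolding Q_def split_level ..
    also have "\<dots> \<longleftrightarrow> ?R"
    proof
      assume "\<exists>r::bool list. \<forall>r' (b::bool). prefix r r' \<longrightarrow> (\<exists>t'\<in>Split p. prefix t t' \<and> length t' = length r')"
      then obtain r :: "bool list" where r: "\<And>r'. prefix r r' \<Longrightarrow> \<exists>t'\<in>Split p. prefix t t' \<and> length t' = length r'"
        by blast
      have "\<exists>t'\<in>Split p. prefix t t' \<and> length t' = n" if "n \<ge> length r" for n
        using r[of "r @ replicate (n - length r) False"] that by simp
      then show ?R by blast
    next
      assume ?R
      then obtain K where K: "\<And>n. n \<ge> K \<Longrightarrow> \<exists>t'\<in>Split p. prefix t t' \<and> length t' = n" by blast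
      have "\<forall>r' (b::bool). prefix (replicate K False) r' \<longrightarrow>
          (\<exists>t'\<in>Split p. prefix t t' \<and> length t' = length r')"
        using K by (auto dest: prefix_length_le)
      then show "\<exists>r::bool list. \<forall>r' (b::bool). prefix r r' \<longrightarrow> (\<exists>t'\<in>Split p. prefix t t' \<and> length t' = length r')"
        by blast
    qed
    finally show ?thesis .
  qed
  show ?thesis
    unfolding FSP_formula_def FSP_iff tree[symmetric] tree_code_ball[OF a] level conj_assoc ..
qed


section \<open>Meeting definable dense sets\<close>

lemma restrict_tree_in_FSP_in:
  assumes p: "p \<in> FSP_in E" and t: "t \<in> p"
  shows "restrict_tree p t \<in> FSP_in E"
proof -
  obtain a where a: "tree_code E p a" using p by (auto simp: FSP_in_def in_model_def)
  have "definable E (\<lambda>e. subset_in E (e 0) (e (Suc 0)) \<or> subset_in E (e (Suc 0)) (e 0))"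
    by (intro definable_basic)
  from separation_definable1[of "\<lambda>s t. subset_in E s t \<or> subset_in E t s" a "node_elem t", OF this]
  obtain y where
    y: "\<And>s. E s y \<longleftrightarrow> E s a \<and> (subset_in E s (node_elem t) \<or> subset_in E (node_elem t) s)" by blast
  have "ext E y = node_elem ` restrict_tree p t"
    by (auto simp: ext_def y tree_codeD[OF a] subset_in_node_elem mem_restrict_tree)
  then show ?thesis
    using p t by (auto simp: FSP_in_def in_model_def tree_code_iff restrict_tree_FSP)
qed

text \<open>The passage from combinatorics to genericity. The property \<open>P\<close> is expressed in the model by \<open>Q\<close>
  with parameters \<open>b\<close> and \<open>c\<close>; the dense set of conditions with \<open>P\<close> is separated from the power set of
  the set of all nodes.\<close>

lemma generic_meets:
  assumes G: "FSP_generic E G"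
    and Q: "\<And>i j k. definable E (\<lambda>e. Q (e i) (e j) (e k))"
    and absolute: "\<And>p x. tree_code E p x \<Longrightarrow> Q x b c \<longleftrightarrow> P p"
    and dense: "\<And>p. p \<in> FSP \<Longrightarrow> \<exists>t\<in>p. P (restrict_tree p t)"
  shows "\<exists>p\<in>G. P p"
proof -
  obtain T where T: "\<And>x. E x T \<longleftrightarrow> (\<exists>t. x = node_elem t)" using ex_full_tree by blast
  obtain PT where PT: "\<And>x. E x PT \<longleftrightarrow> ext E x \<subseteq> ext E T" using ex_power[of T] by blast
  have "definable E (\<lambda>e. FSP_formula E (e 0) (e (Suc 0)) \<and>
      Q (e 0) (e (Suc (Suc 0))) (e (Suc (Suc (Suc 0)))))"
    by (intro definable_conj definable_FSP_formula Q)
  from separation_definable3[of "\<lambda>x T b c. FSP_formula E x T \<and> Q x b c" PT T b c, OF this]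
  obtain d where d: "\<And>x. E x d \<longleftrightarrow> E x PT \<and> FSP_formula E x T \<and> Q x b c" by blast
  define D where "D = {p \<in> FSP_in E. P p}"
  have code: "E x d \<longleftrightarrow> p \<in> D" if x: "tree_code E p x" for p x
  proof -
    have "E x PT" using x by (auto simp: PT T tree_code_iff ext_def)
    then show ?thesis
      using x by (auto simp: d D_def FSP_in_def in_model_def FSP_formula_iff[OF T] absolute)
  qed
  have "set_code E (tree_code E) D d"
    unfolding set_code_def rel_set_def ext_mem
  proof (intro conjI ballI)
    fix p assume p: "p \<in> D"
    then obtain x where x: "tree_code E p x" by (auto simp: D_def FSP_in_def in_model_def)
    with p code show "\<exists>x\<in>ext E d. tree_code E p x" by (auto simp: ext_def)
  next
    fix x assume x: "x \<in> ext E d"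
    then have "ext E x \<subseteq> range node_elem" by (auto simp: d PT T ext_def)
    then have "ext E x = node_elem ` {s. E (node_elem s) x}" by (auto simp: ext_def)
    \<comment> \<open>Every element of the power set codes a set of nodes, so \<open>d\<close> has no members besides codes of
      conditions.\<close>
    then have tc: "tree_code E {s. E (node_elem s) x} x" by (simp only: tree_code_iff)
    with x code show "\<exists>p\<in>D. tree_code E p x" by (auto simp: ext_def)
  qed
  moreover have "is_dense (FSP_in E) D"
    unfolding is_dense_def
  proof (intro conjI ballI)
    show "D \<subseteq> FSP_in E" by (auto simp: D_def)
    fix p assume p: "p \<in> FSP_in E"
    then obtain t where t: "t \<in> p" "P (restrict_tree p t)"
      using dense by (auto simp: FSP_in_def)
    then have "restrict_tree p t \<in> D" using restrict_tree_in_FSP_in[OF p] by (simp add: D_def)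
    moreover have "restrict_tree p t \<subseteq> p" by (auto simp: mem_restrict_tree)
    ultimately show "\<exists>q\<in>D. q \<subseteq> p" by blast
  qed
  ultimately have "G \<inter> D \<noteq> {}"
    using G by (auto simp: FSP_generic_def in_model_def)
  then show ?thesis by (auto simp: D_def)
qed

end


section \<open>Approximating the generic real\<close>

text \<open>The witness is the stem of a common extension of \<open>p\<close> and \<open>q\<close>: it splits in both trees and so lies
  above both stems.\<close>

lemma generic_real_directed:
  assumes "is_filter P G" "P \<subseteq> FSP" "p \<in> G" "q \<in> G"
  obtains s where "s \<in> p" "s \<in> q" "prefix (stem p) s" "prefix (stem q) s"
    "graph_of s \<subseteq> generic_real G"
proof -
  have "\<exists>r\<in>G. r \<subseteq> p \<and> r \<subseteq> q"
    using assms(1,3,4) by (simp add: is_filter_def)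
  then obtain r where r: "r \<in> G" "r \<subseteq> p" "r \<subseteq> q" by blast
  have "G \<subseteq> FSP" using assms(1,2) unfolding is_filter_def by (meson subset_trans)
  then have perf: "perfect_tree p" "perfect_tree q" "perfect_tree r"
    using assms(3,4) r(1) FSP_perfect by blast+
  have stem: "stem r \<in> Split r" by (rule stem_least_split(1)) (rule perf)
  with r have "stem r \<in> Split p" "stem r \<in> Split q" by (auto simp: Split_def)
  then have "prefix (stem p) (stem r)" "prefix (stem q) (stem r)"
    using perf stem_least_split(2) by auto
  moreover have "stem r \<in> p" "stem r \<in> q" using stem r by (auto simp: Split_def)
  moreover have "graph_of (stem r) \<subseteq> generic_real G" using r by (auto simp: generic_real_def)
  ultimately show thesis using that by blast
qed

text \<open>Every condition in the filter contains all finite initial segments of the generic real, since it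
  is compatible with conditions in the filter that have arbitrarily long stems.\<close>

lemma generic_real_approx:
  assumes "is_filter P G" "P \<subseteq> FSP" and long: "\<And>n. \<exists>p\<in>G. n < length (stem p)" and q: "q \<in> G"
  obtains s where "s \<in> q" "length s = k" "graph_of s \<subseteq> generic_real G"
proof -
  obtain p where p: "p \<in> G" "k < length (stem p)" using long by blast
  obtain s where s: "s \<in> q" "prefix (stem p) s" "graph_of s \<subseteq> generic_real G"
    using generic_real_directed[OF assms(1,2) p(1) q] by metis
  have "is_tree q" using assms q by (auto simp: is_filter_def FSP_is_tree)
  then have "take k s \<in> q" using s(1) tree_prefix_closed take_is_prefix by blast
  moreover have "length (take k s) = k" using p(2) prefix_length_le[OF s(2)] by simp
  moreover have "graph_of (take k s) \<subseteq> generic_real G"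
    using s(3) graph_of_subset_iff take_is_prefix by (metis order.trans)
  ultimately show thesis using that by blast
qed

lemma generic_real_function:
  assumes "is_filter P G" "P \<subseteq> FSP" and long: "\<And>n. \<exists>p\<in>G. n < length (stem p)"
  obtains f where "generic_real G = {(n, f n) | n. True}"
proof -
  have unique: "b = b'" if x: "(n, b) \<in> generic_real G" "(n, b') \<in> generic_real G" for n b b'
  proof -
    obtain p q where pq: "p \<in> G" "(n, b) \<in> graph_of (stem p)" "q \<in> G" "(n, b') \<in> graph_of (stem q)"
      using x by (auto simp: generic_real_def)
    then obtain s where "prefix (stem p) s" "prefix (stem q) s"
      using generic_real_directed[OF assms(1,2) pq(1) pq(3)] by metis
    with pq have "(n, b) \<in> graph_of s" "(n, b') \<in> graph_of s" by (meson graph_of_subset_iff subsetD)+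
    then show ?thesis by (simp add: mem_graph_of)
  qed
  have "\<exists>b. (n, b) \<in> generic_real G" for n
    using long[of n] by (auto simp: generic_real_def mem_graph_of)
  then obtain f where f: "\<And>n. (n, f n) \<in> generic_real G" by metis
  then have "generic_real G = {(n, f n) | n. True}" using unique by auto
  then show thesis by (rule that)
qed

text \<open>If the digit \<open>(n, b)\<close> occurs in every condition of the filter, it occurs in one whose stem is
  longer than \<open>n\<close>. The nodes of that condition are comparable with the stem, so \<open>b\<close> is the value of
  the stem at \<open>n\<close>.\<close>

lemma generic_real_eq_Inter:
  assumes "is_filter P G" "P \<subseteq> FSP" and long: "\<And>n. \<exists>p\<in>G. n < length (stem p)"
  shows "generic_real G = (\<Inter>p\<in>G. \<Union> (graph_of ` p))"
proof -
  obtain f where f: "generic_real G = {(n, f n) | n. True}"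
    using generic_real_function[OF assms] .
  have "z \<in> generic_real G \<longleftrightarrow> (\<forall>p\<in>G. \<exists>s\<in>p. z \<in> graph_of s)" for z
  proof -
    obtain n b where z: "z = (n, b)" by fastforce
    show ?thesis
    proof
      assume zx: "z \<in> generic_real G"
      show "\<forall>p\<in>G. \<exists>s\<in>p. z \<in> graph_of s"
      proof
        fix p assume "p \<in> G"
        then obtain s where s: "s \<in> p" "length s = Suc n" "graph_of s \<subseteq> generic_real G"
          using generic_real_approx[OF assms] by metis
        have "(n, s ! n) \<in> graph_of s" using s(2) by (simp add: mem_graph_of)
        then have "z \<in> graph_of s" using zx s(3) f z by auto
        with s(1) show "\<exists>s\<in>p. z \<in> graph_of s" by blast
      qed
    next
      assume all: "\<forall>p\<in>G. \<exists>s\<in>p. z \<in> graph_of s"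
      obtain p where p: "p \<in> G" "n < length (stem p)" using long by blast
      then obtain s where s: "s \<in> p" "z \<in> graph_of s" using all by blast
      have "perfect_tree p" using assms p by (auto simp: is_filter_def intro: FSP_perfect)
      then have "prefix s (stem p) \<or> prefix (stem p) s" using stem_comparable s(1) by blast
      then have "z \<in> graph_of (stem p)"
        using s(2) p(2) unfolding z by (auto simp: mem_graph_of prefix_def nth_append)
      with p(1) show "z \<in> generic_real G" by (auto simp: generic_real_def)
    qed
  qed
  then show ?thesis by auto
qed

section \<open>Dense properties of conditions\<close>

text \<open>The stem is longer than \<open>n\<close> if all nodes are comparable with some node \<open>u\<close> defined at \<open>n\<close>; this
  avoids speaking of least splitting nodes.\<close>

definition confines_in :: "('m \<Rightarrow> 'm \<Rightarrow> bool) \<Rightarrow> 'm \<Rightarrow> 'm \<Rightarrow> bool" where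
  "confines_in E p n \<longleftrightarrow> (\<exists>u. E u p \<and> (\<exists>z b. E z u \<and> is_pair E n b z) \<and>
     (\<forall>s. E s p \<longrightarrow> subset_in E s u \<or> subset_in E u s))"

definition avoids_in :: "('m \<Rightarrow> 'm \<Rightarrow> bool) \<Rightarrow> 'm \<Rightarrow> 'm \<Rightarrow> bool" where
  "avoids_in E p x \<longleftrightarrow> (\<exists>z. E z x \<and> (\<forall>s. E s p \<longrightarrow> \<not> E z s))"

text \<open>For a pair \<open>c\<close>, having no repeated value \<open>b\<close> on \<open>c\<close> means taking both values; put this way, the
  formula does not have to express which member of \<open>c\<close> succeeds the other.\<close>

definition separates_in :: "('m \<Rightarrow> 'm \<Rightarrow> bool) \<Rightarrow> 'm \<Rightarrow> 'm \<Rightarrow> 'm \<Rightarrow> bool" where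
  "separates_in E p S N \<longleftrightarrow> (\<exists>c. E c S \<and> (\<forall>m. E m c \<longrightarrow> \<not> E m N) \<and>
     (\<forall>s. E s p \<longrightarrow> (\<forall>m. E m c \<longrightarrow> (\<forall>m'. E m' c \<longrightarrow> (\<forall>b z z'.
        (E z s \<and> is_pair E m b z) \<and> (E z' s \<and> is_pair E m' b z') \<longrightarrow> m = m')))))"

lemma definable_confines_in: "definable E (\<lambda>e. confines_in E (e i) (e j))"
  unfolding confines_in_def by (intro definable_basic)

lemma definable_avoids_in: "definable E (\<lambda>e. avoids_in E (e i) (e j))"
  unfolding avoids_in_def by (intro definable_basic)

lemma definable_separates_in: "definable E (\<lambda>e. separates_in E (e i) (e j) (e k))"
  unfolding separates_in_def by (intro definable_basic)

lemma FSP_split_at: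
  assumes "p \<in> FSP"
  shows "\<exists>K. \<forall>n\<ge>K. \<exists>t\<in>Split p. length t = n"
proof -
  have "[] \<in> p" using FSP_is_tree[OF assms] by (auto simp: is_tree_def)
  then obtain K where "\<forall>n\<ge>K. \<exists>t'\<in>Split p. prefix [] t' \<and> length t' = n"
    using assms unfolding FSP_iff by blast
  then show ?thesis by blast
qed

lemma Split_children: "t \<in> Split p \<Longrightarrow> t @ [b] \<in> p"
  by (cases b) (auto simp: Split_def)

context transitive_ZFC_model
begin

lemma generic_long_stem:
  assumes "FSP_generic E G"
  shows "\<exists>p\<in>G. n < length (stem p)"
proof -
  have "\<exists>p\<in>G. \<exists>u\<in>p. n < length u \<and> (\<forall>s\<in>p. prefix s u \<or> prefix u s)"
  proof (rule generic_meets[where Q = "\<lambda>x a c. confines_in E x a" and b = "nat_elem n" and c = "nat_elem n",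
        OF assms definable_confines_in])
    fix p x assume x: "tree_code E p x"
    have level: "(\<exists>z b. E z (node_elem u) \<and> is_pair E (nat_elem n) b z) \<longleftrightarrow> n < length u" for u
      by (auto simp: mem_node_elem graph_of_def is_pair_digit_elem nat_elem_inject)
    show "confines_in E x (nat_elem n) \<longleftrightarrow>
        (\<exists>u\<in>p. n < length u \<and> (\<forall>s\<in>p. prefix s u \<or> prefix u s))"
      unfolding confines_in_def tree_code_bex[OF x] tree_code_ball[OF x] level subset_in_node_elem ..
  next
    fix p assume p: "p \<in> FSP"
    obtain K where K: "\<forall>m\<ge>K. \<exists>t\<in>Split p. length t = m" using FSP_split_at[OF p] by blast
    then obtain t where t: "t \<in> Split p" "length t = max K (Suc n)" by (meson max.cobounded1)
    then have "t \<in> p" "n < length t" by (auto simp: Split_def)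
    then show "\<exists>t\<in>p. \<exists>u\<in>restrict_tree p t. n < length u \<and>
        (\<forall>s\<in>restrict_tree p t. prefix s u \<or> prefix u s)"
      by (intro bexI[of _ t]) (auto simp: mem_restrict_tree)
  qed
  then obtain p u where p: "p \<in> G" "n < length u" "\<forall>s\<in>p. prefix s u \<or> prefix u s" by blast
  have "perfect_tree p"
    using assms p(1) by (auto simp: FSP_generic_def is_filter_def FSP_in_def intro: FSP_perfect)
  then have "prefix u (stem p)" using p(3) by (intro prefix_stem) auto
  then have "length u \<le> length (stem p)" by (rule prefix_length_le)
  with p show ?thesis by (intro bexI[of _ p]) auto
qed

text \<open>Above the child of a splitting node \<open>t\<close> that disagrees with \<open>f\<close>, the digit of \<open>f\<close> at the length of
  \<open>t\<close> no longer occurs.\<close>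

lemma generic_avoids:
  assumes G: "FSP_generic E G" and a: "set_code E (digit_code E) {(n, f n) | n. True} a"
  shows "\<exists>p\<in>G. \<exists>n. \<forall>s\<in>p. (n, f n) \<notin> graph_of s"
proof (rule generic_meets[where Q = "\<lambda>x a c. avoids_in E x a" and b = a and c = a,
      OF G definable_avoids_in])
  fix p x assume x: "tree_code E p x"
  have a': "E z a \<longleftrightarrow> (\<exists>n. z = digit_elem (n, f n))" for z
    using a by (auto simp: digit_set_code_iff ext_def set_eq_iff)
  show "avoids_in E x a \<longleftrightarrow> (\<exists>n. \<forall>s\<in>p. (n, f n) \<notin> graph_of s)"
    unfolding avoids_in_def tree_code_ball[OF x] a' digit_elem_mem_node_elem[symmetric] by blast
next
  fix p assume p: "p \<in> FSP"
  obtain t where t: "t \<in> Split p" using FSP_split_at[OF p] by blast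
  define t' where "t' = t @ [\<not> f (length t)]"
  have "t' \<in> p" using t by (simp add: t'_def Split_children)
  moreover have "(length t, f (length t)) \<notin> graph_of s" if "s \<in> restrict_tree p t'" for s
    using that by (auto simp: mem_restrict_tree t'_def mem_graph_of prefix_def nth_append append_eq_append_conv2
      Cons_eq_append_conv append_eq_Cons_conv)
  ultimately show "\<exists>t\<in>p. \<exists>n. \<forall>s\<in>restrict_tree p t. (n, f n) \<notin> graph_of s" by blast
qed

text \<open>The use of fatness: a large enough \<open>m\<close> with \<open>{m, Suc m} \<in> S\<close> comes with a splitting node \<open>t\<close> of
  length \<open>Suc m\<close>. Its digit at \<open>m\<close> is fixed and the one at \<open>Suc m\<close> is free, so it can be chosen to be
  different.\<close>

lemma generic_separates:
  assumes G: "FSP_generic E G"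
    and a: "set_code E (set_code E (nat_code E)) S a"
    and S: "\<And>K. \<exists>m\<ge>K. {m, Suc m} \<in> S"
  shows "\<exists>p\<in>G. \<exists>C\<in>S. (\<forall>m\<in>C. N \<le> m) \<and>
    (\<forall>s\<in>p. \<forall>m\<in>C. \<forall>m'\<in>C. m < length s \<and> m' < length s \<and> s ! m = s ! m' \<longrightarrow> m = m')"
proof (rule generic_meets[where Q = "separates_in E" and b = a and c = "nat_elem N",
      OF G definable_separates_in])
  fix p x assume x: "tree_code E p x"
  have "set_code E (nat_code E) C c \<longleftrightarrow> ext E c = nat_elem ` C" for C c
    by (rule set_code_graph) (rule nat_code_iff)
  then have C1: "\<And>C. C \<in> S \<Longrightarrow> \<exists>c. E c a \<and> ext E c = nat_elem ` C"
    and C2: "\<And>c. E c a \<Longrightarrow> \<exists>C\<in>S. ext E c = nat_elem ` C"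
    using a by (auto simp: set_code_def[of E "set_code E (nat_code E)"] rel_set_def ext_mem Bex_def)
  have pair: "E z (node_elem s) \<and> is_pair E (nat_elem m) b z \<longleftrightarrow>
      m < length s \<and> b = nat_elem (of_bool (s ! m)) \<and> z = digit_elem (m, s ! m)" for z s m b
    by (auto simp: mem_node_elem graph_of_def is_pair_digit_elem nat_elem_inject)
  have digits: "(\<forall>b z z'. (E z (node_elem s) \<and> is_pair E (nat_elem m) b z) \<and>
        (E z' (node_elem s) \<and> is_pair E (nat_elem m') b z') \<longrightarrow> nat_elem m = nat_elem m') \<longleftrightarrow>
      (m < length s \<and> m' < length s \<and> s ! m = s ! m' \<longrightarrow> m = m')" for s m m'
    unfolding pair nat_elem_inject by (metis nat_elem_of_bool_inject)
  define L where "L c \<longleftrightarrow> (\<forall>m. E m c \<longrightarrow> \<not> E m (nat_elem N)) \<and>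
      (\<forall>s. E s x \<longrightarrow> (\<forall>m. E m c \<longrightarrow> (\<forall>m'. E m' c \<longrightarrow> (\<forall>b z z'.
        (E z s \<and> is_pair E m b z) \<and> (E z' s \<and> is_pair E m' b z') \<longrightarrow> m = m'))))" for c
  have L: "L c \<longleftrightarrow> (\<forall>m\<in>C. N \<le> m) \<and>
      (\<forall>s\<in>p. \<forall>m\<in>C. \<forall>m'\<in>C. m < length s \<and> m' < length s \<and> s ! m = s ! m' \<longrightarrow> m = m')"
    if c: "ext E c = nat_elem ` C" for c C
  proof -
    have "E m c \<longleftrightarrow> (\<exists>k\<in>C. m = nat_elem k)" for m using c by (auto simp: ext_def set_eq_iff)
    then have ball: "(\<forall>m. E m c \<longrightarrow> R m) \<longleftrightarrow> (\<forall>m\<in>C. R (nat_elem m))" for R by auto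
    show ?thesis
      unfolding L_def tree_code_ball[OF x] ball digits mem_nat_elem_nat_elem not_less ..
  qed
  show "separates_in E x a (nat_elem N) \<longleftrightarrow> (\<exists>C\<in>S. (\<forall>m\<in>C. N \<le> m) \<and>
      (\<forall>s\<in>p. \<forall>m\<in>C. \<forall>m'\<in>C. m < length s \<and> m' < length s \<and> s ! m = s ! m' \<longrightarrow> m = m'))"
    (is "_ \<longleftrightarrow> (\<exists>C\<in>S. ?R C)")
  proof -
    have "separates_in E x a (nat_elem N) \<longleftrightarrow> (\<exists>c. E c a \<and> L c)"
      unfolding separates_in_def L_def ..
    also have "\<dots> \<longleftrightarrow> (\<exists>C\<in>S. ?R C)"
    proof
      assume "\<exists>c. E c a \<and> L c"
      then obtain c where "E c a" "L c" by blast
      with C2 L show "\<exists>C\<in>S. ?R C" by meson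
    next
      assume "\<exists>C\<in>S. ?R C"
      then obtain C where C: "C \<in> S" "?R C" by blast
      obtain c where "E c a" "ext E c = nat_elem ` C" using C1[OF C(1)] by blast
      with L C(2) show "\<exists>c. E c a \<and> L c" by blast
    qed
    finally show ?thesis .
  qed
next
  fix p assume p: "p \<in> FSP"
  obtain K where K: "\<forall>m\<ge>K. \<exists>t\<in>Split p. length t = m" using FSP_split_at[OF p] by blast
  obtain m where m: "m \<ge> max K N" "{m, Suc m} \<in> S" using S by blast
  obtain t where t: "t \<in> Split p" "length t = Suc m" using K m(1) by (auto dest: spec[of _ "Suc m"])
  define t' where "t' = t @ [\<not> t ! m]"
  have t': "t' \<in> p" using t by (simp add: t'_def Split_children)
  have differ: "s ! m \<noteq> s ! Suc m" if "s \<in> restrict_tree p t'" "Suc m < length s" for s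
  proof -
    have "prefix t' s"
      using that prefix_length_prefix[of t' t' s] t(2) by (auto simp: mem_restrict_tree t'_def)
    then show ?thesis using t(2) by (auto simp: prefix_def t'_def nth_append)
  qed
  show "\<exists>t\<in>p. \<exists>C\<in>S. (\<forall>m\<in>C. N \<le> m) \<and> (\<forall>s\<in>restrict_tree p t. \<forall>m\<in>C. \<forall>m'\<in>C.
      m < length s \<and> m' < length s \<and> s ! m = s ! m' \<longrightarrow> m = m')"
  proof (intro bexI[OF _ t'] bexI[OF _ m(2)] conjI ballI impI)
    fix k assume "k \<in> {m, Suc m}"
    then show "N \<le> k" using m(1) by auto
  next
    fix s k k'
    assume "s \<in> restrict_tree p t'" "k \<in> {m, Suc m}" "k' \<in> {m, Suc m}"
      "k < length s \<and> k' < length s \<and> s ! k = s ! k'"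
    then show "k = k'" using differ[of s] by auto
  qed
qed

text \<open>The intersection is separated from the union of a single member of \<open>G\<close>.\<close>

lemma Inter_digits_in_model:
  assumes "in_model (set_code E (tree_code E)) G" "G \<noteq> {}"
  shows "in_model (set_code E (digit_code E)) (\<Inter>p\<in>G. \<Union> (graph_of ` p))"
proof -
  obtain g where g: "set_code E (tree_code E) G g" using assms(1) by (auto simp: in_model_def)
  then have g1: "\<And>p. p \<in> G \<Longrightarrow> \<exists>x. E x g \<and> tree_code E p x"
    and g2: "\<And>x. E x g \<Longrightarrow> \<exists>p\<in>G. tree_code E p x"
    by (auto simp: set_code_def[of E "tree_code E"] rel_set_def ext_mem Bex_def)
  obtain p0 x0 where p0: "p0 \<in> G" "E x0 g" "tree_code E p0 x0" using assms(2) g1 by blast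
  obtain u where u: "\<And>z. E z u \<longleftrightarrow> (\<exists>s. E s x0 \<and> E z s)" using union[of x0] by auto
  have "definable E (\<lambda>e. \<forall>x. E x (e (Suc 0)) \<longrightarrow> (\<exists>s. E s x \<and> E (e 0) s))"
    by (intro definable_basic)
  from separation_definable1[of "\<lambda>z g. \<forall>x. E x g \<longrightarrow> (\<exists>s. E s x \<and> E z s)" u g, OF this]
  obtain y where y: "\<And>z. E z y \<longleftrightarrow> E z u \<and> (\<forall>x. E x g \<longrightarrow> (\<exists>s. E s x \<and> E z s))" by blast
  have in_tree: "(\<exists>s. E s x \<and> E (digit_elem d) s) \<longleftrightarrow> d \<in> \<Union> (graph_of ` p)" if "tree_code E p x" for p x d
    unfolding tree_code_bex[OF that] by (auto simp: digit_elem_mem_node_elem)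
  have "E (digit_elem d) y \<longleftrightarrow> d \<in> (\<Inter>p\<in>G. \<Union> (graph_of ` p))" for d
  proof -
    have "E (digit_elem d) y \<longleftrightarrow> (\<forall>x. E x g \<longrightarrow> (\<exists>s. E s x \<and> E (digit_elem d) s))"
      unfolding y u using p0(2) by blast
    also have "\<dots> \<longleftrightarrow> (\<forall>p\<in>G. d \<in> \<Union> (graph_of ` p))"
      using g1 g2 in_tree[of _ _ d] by meson
    finally show ?thesis by simp
  qed
  moreover have "\<exists>d. z = digit_elem d" if "E z y" for z
    using that unfolding y u tree_codeD[OF p0(3)] by (metis mem_node_elem)
  ultimately have "ext E y = digit_elem ` (\<Inter>p\<in>G. \<Union> (graph_of ` p))"
    unfolding set_eq_iff ext_mem image_iff by metis
  then show ?thesis unfolding in_model_def digit_set_code_iff by blast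
qed

end

theorem proposition1p5:
  fixes E :: "'m \<Rightarrow> 'm \<Rightarrow> bool"
    and G :: "bool list set set"
  assumes "transitive_ZFC_model E"
    and "FSP_generic E G"
  shows "generic_real G \<in> Cantor_space \<and>
    \<not> in_model (set_code E (digit_code E)) (generic_real G) \<and>
    (\<forall>F :: 'n \<Rightarrow> 'n \<Rightarrow> bool.
       transitive_ZFC_model F \<and> in_model (set_code F (tree_code F)) G \<longrightarrow>
       in_model (set_code F (digit_code F)) (generic_real G)) \<and>
    (\<forall>n :: nat \<Rightarrow> nat.
       infinite {{n i, n i + 1} | i. True} \<and>
       in_model (set_code E (set_code E (nat_code E))) {{n i, n i + 1} | i. True} \<longrightarrow>
       infinite {i. card (subset_of_real (generic_real G) \<inter> {n i, n i + 1}) = 1})"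
proof -
  interpret transitive_ZFC_model E by fact
  have filter: "is_filter (FSP_in E) G" using assms(2) by (simp add: FSP_generic_def)
  have sub: "FSP_in E \<subseteq> FSP" by (auto simp: FSP_in_def)
  note long = generic_long_stem[OF assms(2)]
  obtain f where f: "generic_real G = {(n, f n) | n. True}"
    using generic_real_function[OF filter sub long] .
  note Inter = generic_real_eq_Inter[OF filter sub long]
  have "generic_real G \<in> Cantor_space" unfolding f Cantor_space_def by blast
  moreover have "\<not> in_model (set_code E (digit_code E)) (generic_real G)"
  proof
    assume "in_model (set_code E (digit_code E)) (generic_real G)"
    then obtain a where "set_code E (digit_code E) {(n, f n) | n. True} a"
      by (auto simp: in_model_def f)
    from generic_avoids[OF assms(2) this]
    obtain p n where "p \<in> G" "\<forall>s\<in>p. (n, f n) \<notin> graph_of s" by blast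
    then have "(n, f n) \<notin> generic_real G" unfolding Inter by blast
    then show False by (simp add: f)
  qed
  moreover have "in_model (set_code F (digit_code F)) (generic_real G)"
    if "transitive_ZFC_model F \<and> in_model (set_code F (tree_code F)) G" for F :: "'n \<Rightarrow> 'n \<Rightarrow> bool"
    unfolding Inter using that filter
    by (intro transitive_ZFC_model.Inter_digits_in_model) (auto simp: is_filter_def)
  moreover have "infinite {i. card (subset_of_real (generic_real G) \<inter> {n i, n i + 1}) = 1}"
    if n: "infinite {{n i, n i + 1} | i. True} \<and>
      in_model (set_code E (set_code E (nat_code E))) {{n i, n i + 1} | i. True}"
    for n :: "nat \<Rightarrow> nat"
  proof
    let ?S = "{{n i, n i + 1} | i. True}"
    let ?I = "{i. card (subset_of_real (generic_real G) \<inter> {n i, n i + 1}) = 1}"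
    assume fin: "finite ?I"
    obtain N where N: "\<And>i. i \<in> ?I \<Longrightarrow> n i < N"
      using finite_nat_set_iff_bounded[of "n ` ?I"] fin by blast
    obtain a where a: "set_code E (set_code E (nat_code E)) ?S a"
      using n by (auto simp: in_model_def)
    have unbounded: "\<exists>m\<ge>K. {m, Suc m} \<in> ?S" for K
    proof (rule ccontr)
      assume "\<not> ?thesis"
      then have "n i < K" for i by (metis (mono_tags, lifting) Suc_eq_plus1 mem_Collect_eq not_less)
      then have "?S \<subseteq> (\<lambda>m. {m, m + 1}) ` {..<K}" by auto
      with n show False using finite_surj by blast
    qed
    from generic_separates[OF assms(2) a unbounded, of N]
    obtain p C where p: "p \<in> G" and C: "C \<in> ?S" "\<forall>m\<in>C. N \<le> m"
      and differ: "\<forall>s\<in>p. \<forall>m\<in>C. \<forall>m'\<in>C. m < length s \<and> m' < length s \<and> s ! m = s ! m' \<longrightarrow> m = m'"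
      by (elim bexE conjE)
    from C(1) obtain i where i: "C = {n i, n i + 1}" by blast
    obtain s where s: "s \<in> p" "length s = n i + 2" "graph_of s \<subseteq> generic_real G"
      using generic_real_approx[OF filter sub long p] .
    have "s ! n i \<noteq> s ! (n i + 1)" using differ[rule_format, of s "n i" "n i + 1"] s i by auto
    moreover have "s ! k = f k" if "k < n i + 2" for k
    proof -
      have "(k, s ! k) \<in> graph_of s" using that s(2) by (simp add: mem_graph_of)
      with s(3) f show ?thesis by auto
    qed
    ultimately have "f (n i) \<noteq> f (n i + 1)" by simp
    moreover have "subset_of_real (generic_real G) = {k. f k}"
      by (auto simp: subset_of_real_def f)
    ultimately have "subset_of_real (generic_real G) \<inter> {n i, n i + 1} =
        {if f (n i) then n i else n i + 1}" by auto
    then have "i \<in> ?I" by simp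
    with N have "n i < N" by blast
    with C(2) i show False by auto
  qed
  ultimately show ?thesis by blast
qed

end
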